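(* Let $d\ge2$, $\rho_1,\dots,\rho_d\in(0,1)$ with $|\rho|=\rho_1+\cdots+\rho_d<1$. Let $(12\dots d)$ be the cyclic permutation $1\mapsto2\mapsto\cdots\mapsto d\mapsto1$. For $\nu,\mu\in\mathbb N_0^d$ with $|\nu|=|\mu|=n$, the normalized connection coefficients of the Krawtchouk polynomials satisfy $$\widehat{\mathsf k}_{\nu,\mu}^{\,(12\dots d)}(\rho)=(-1)^{n+\nu_d}\sqrt{\mathsf K_{\hat\rho,n}(\nu_1,\dots,\nu_{d-1})}\;\widehat{\mathsf K}_{(\mu_2,\mu_3,\dots,\mu_d)}\big((\nu_1,\dots,\nu_{d-1});\hat\rho,n\big),$$ where $\hat\rho=(\hat\rho_1,\dots,\hat\rho_{d-1})$ with $$\hat\rho_j=\frac{\rho_1\rho_{j+1}}{(1-\rho_1)(1+\rho_1-|\boldsymbol\rho_{j+1}|)(1+\rho_1-|\boldsymbol\rho_j|)}.$$ Furthermore, $$\widehat{\mathsf k}_{\nu,\mu}^{\,(12\dots d)}(\rho)=(-1)^{n+\nu_d}\sqrt{\mathsf K_{\tilde\rho,n}(\mu_d,\mu_{d-1},\dots,\mu_2)}\;\widehat{\mathsf K}_{(\nu_{d-1},\nu_{d-2},\dots,\nu_1)}\big((\mu_d,\mu_{d-1},\dots,\mu_2);\tilde\rho,n\big),$$ where $\tilde\rho=(\tilde\rho_1,\dots,\tilde\rho_{d-1})$ with $$\tilde\rho_j=\frac{\rho_1\rho_{d+1-j}(1-|\rho|)}{(1-|\boldsymbol\rho_{d-j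}|)(1-|\boldsymbol\rho_{d+1-j}|)(1+\rho_1-|\rho|)}.$$
   Context: **Vectors.** $|y|$ is the sum of the entries of $y$; $\mathbf y_j=(y_1,\dots,y_j)$ (so $|\boldsymbol\rho_j|=\rho_1+\cdots+\rho_j$); $\mathbf y^j=(y_j,\dots)$ is the tail from the $j$-th to the last entry; empty parts have sum $0$. $(a)_k=a(a+1)\cdots(a+k-1)$. **Krawtchouk polynomials of $p$ variables.** For $\rho\in(0,1)^p$ with $|\rho|<1$ and $N\in\mathbb N_0$, the weight is $$\mathsf K_{\rho,N}(x)=N!\prod_{i=1}^p\frac{\rho_i^{x_i}}{x_i!}\;\frac{(1-|\rho|)^{N-|x|}}{(N-|x|)!},\qquad x\in\mathbb N_0^p,\ |x|\le N,$$ with inner product $\langle f,g\rangle_{\mathsf K_{\rho,N}}=\sum_{x\in\mathbb N_0^p,|x|\le N}f(x)g(x)\mathsf K_{\rho,N}(x)$. For $\nu\in\mathbb N_0^p$, $|\nu|\le N$, $$\mathsf K_\nu(x;\rho,N)=\frac1{(-N)_{|\nu|}}\prod_{j=1}^p(-N+|\mathbf x_{j-1}|+|\boldsymbol\nu^{j+1}|)_{\nu_j}\;{}_2F_1\!\left(\begin{matrix}-\nu_j,\,-x_j\\-N+|\mathbf x_{j-1}|+|\boldsymbol\nu^{j+1}|\end{matrix};\frac{1-|\boldsymbol\rho_{j-1}|}{\rho_j}\right),$$ where $(c)_m\,{}_2F_1(-m,-x;c;z)$ means the polynomial $\sum_{k=0}^m\frac{(-m)_k(-x)_k}{k!}(c+k)_{m-k}z^k$.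 For $n\le N$ the $\mathsf K_\nu(\cdot;\rho,N)$, $|\nu|=n$, form an orthogonal basis of the space $\mathcal V_n^p(\mathsf K_{\rho,N})$ of degree-$n$ orthogonal polynomials; $\mathsf C_\nu(\rho,N)=\langle\mathsf K_\nu,\mathsf K_\nu\rangle_{\mathsf K_{\rho,N}}$ and $\widehat{\mathsf K}_\nu=\mathsf C_\nu(\rho,N)^{-1/2}\mathsf K_\nu$ is the orthonormal polynomial. **Connection coefficients.** In dimension $d$, for $\tau=(12\dots d)$ put $\tau\alpha=(\alpha_{\tau(1)},\dots,\alpha_{\tau(d)})$ and $\tau\rho=(\rho_{\tau(1)},\dots,\rho_{\tau(d)})$. For any $N\ge n$ the $\widehat{\mathsf k}_{\nu,\mu}^{\,\tau}(\rho)$ are defined by $$\widehat{\mathsf K}_\nu(\tau\alpha;\tau\rho,N)=\sum_{|\mu|=n}\widehat{\mathsf k}_{\nu,\mu}^{\,\tau}(\rho)\,\widehat{\mathsf K}_\mu(\alpha;\rho,N),\qquad|\nu|=n;$$ they do not depend on the choice of $N\ge n$. *)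

theory Defs
  imports "HOL-Analysis.Analysis" "HOL-Combinatorics.Cycles"
begin

text \<open>
  A vector with entries numbered from 1 to p is a function on the natural numbers of which only the
  values on \<open>{1..p}\<close> matter.  Multi-indices are in addition required to vanish off \<open>{1..p}\<close>, so
  that each element of \<open>\<nat>\<^sub>0\<^sup>p\<close> has exactly one representative.
\<close>

definition multi_indices :: "nat \<Rightarrow> nat \<Rightarrow> (nat \<Rightarrow> nat) set" where
  "multi_indices p n = {\<nu>. (\<forall>i. i \<notin> {1..p} \<longrightarrow> \<nu> i = 0) \<and> (\<Sum>i=1..p. \<nu> i) = n}"

definition grid :: "nat \<Rightarrow> nat \<Rightarrow> (nat \<Rightarrow> nat) set" where
  "grid p N = {x. (\<forall>i. i \<notin> {1..p} \<longrightarrow> x i = 0) \<and> (\<Sum>i=1..p. x i) \<le> N}"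

text \<open>The exponent and the factorial use truncated subtraction: meant for \<open>\<bar>x\<bar> \<le> N\<close> only.\<close>

definition kraw_weight :: "nat \<Rightarrow> (nat \<Rightarrow> real) \<Rightarrow> nat \<Rightarrow> (nat \<Rightarrow> nat) \<Rightarrow> real" where
  "kraw_weight p \<rho> N x =
     fact N * (\<Prod>i=1..p. \<rho> i ^ x i / fact (x i)) *
     ((1 - (\<Sum>i=1..p. \<rho> i)) ^ (N - (\<Sum>i=1..p. x i)) / fact (N - (\<Sum>i=1..p. x i)))"

definition kraw_inner ::
    "nat \<Rightarrow> (nat \<Rightarrow> real) \<Rightarrow> nat \<Rightarrow> ((nat \<Rightarrow> real) \<Rightarrow> real) \<Rightarrow> ((nat \<Rightarrow> real) \<Rightarrow> real) \<Rightarrow> real" where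
  "kraw_inner p \<rho> N f g =
     (\<Sum>x\<in>grid p N. f (\<lambda>i. real (x i)) * g (\<lambda>i. real (x i)) * kraw_weight p \<rho> N x)"

text \<open>
  The polynomial \<open>(c)\<^sub>m \<cdot> \<^sub>2F\<^sub>1(-m, -x; c; z)\<close>, with the Pochhammer factor multiplied in
  so that no denominator \<open>(c)\<^sub>k\<close> can vanish.
\<close>

definition pochhammer_2F1 :: "nat \<Rightarrow> real \<Rightarrow> real \<Rightarrow> real \<Rightarrow> real" where
  "pochhammer_2F1 m x c z =
     (\<Sum>k=0..m. pochhammer (- real m) k * pochhammer (- x) k / fact k *
        pochhammer (c + real k) (m - k) * z ^ k)"

text \<open>
  The Krawtchouk polynomial \<open>K\<^sub>\<nu>(x; \<rho>, N)\<close> of \<open>p\<close> variables, as a polynomial function of real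
  \<open>x\<close>.
\<close>

definition kraw ::
    "nat \<Rightarrow> (nat \<Rightarrow> real) \<Rightarrow> nat \<Rightarrow> (nat \<Rightarrow> nat) \<Rightarrow> (nat \<Rightarrow> real) \<Rightarrow> real" where
  "kraw p \<rho> N \<nu> x =
     1 / pochhammer (- real N) (\<Sum>i=1..p. \<nu> i) *
     (\<Prod>j=1..p. pochhammer_2F1 (\<nu> j) (x j)
        (- real N + (\<Sum>i\<in>{1..<j}. x i) + real (\<Sum>i\<in>{j<..p}. \<nu> i))
        ((1 - (\<Sum>i\<in>{1..<j}. \<rho> i)) / \<rho> j))"

definition kraw_norm2 :: "nat \<Rightarrow> (nat \<Rightarrow> real) \<Rightarrow> nat \<Rightarrow> (nat \<Rightarrow> nat) \<Rightarrow> real" where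
  "kraw_norm2 p \<rho> N \<nu> = kraw_inner p \<rho> N (kraw p \<rho> N \<nu>) (kraw p \<rho> N \<nu>)"

definition kraw_hat ::
    "nat \<Rightarrow> (nat \<Rightarrow> real) \<Rightarrow> nat \<Rightarrow> (nat \<Rightarrow> nat) \<Rightarrow> (nat \<Rightarrow> real) \<Rightarrow> real" where
  "kraw_hat p \<rho> N \<nu> x = kraw p \<rho> N \<nu> x / sqrt (kraw_norm2 p \<rho> N \<nu>)"

text \<open>
  For a permutation \<open>\<tau>\<close> of \<open>{1..d}\<close>, the family \<open>\<mu> \<mapsto> k\<^sup>\<tau>\<^sub>\<nu>\<^sub>,\<^sub>\<mu>(\<rho>)\<close> (normalized) is the unique family,
  indexed by the \<open>\<mu>\<close> with \<open>\<bar>\<mu>\<bar> = \<bar>\<nu>\<bar>\<close> and set to 0 elsewhere, that gives the expansion below as an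
  identity of polynomials in \<open>\<alpha>\<close>.  Here \<open>\<tau>\<alpha> = (\<alpha>\<^bsub>\<tau>(1)\<^esub>, \<dots>, \<alpha>\<^bsub>\<tau>(d)\<^esub>)\<close> is \<open>\<alpha> \<circ> \<tau>\<close>.
  The expansion is at a given \<open>N \<ge> \<bar>\<nu>\<bar>\<close>, which is therefore an argument, although
  the coefficients do not depend on it.
\<close>

definition kraw_conn ::
    "nat \<Rightarrow> (nat \<Rightarrow> nat) \<Rightarrow> (nat \<Rightarrow> real) \<Rightarrow> nat \<Rightarrow> (nat \<Rightarrow> nat) \<Rightarrow> (nat \<Rightarrow> nat) \<Rightarrow> real" where
  "kraw_conn d \<tau> \<rho> N \<nu> =
     (THE c. (\<forall>\<mu>. \<mu> \<notin> multi_indices d (\<Sum>i=1..d. \<nu> i) \<longrightarrow> c \<mu> = 0) \<and>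
        (\<forall>\<alpha>. kraw_hat d (\<rho> \<circ> \<tau>) N \<nu> (\<alpha> \<circ> \<tau>) =
             (\<Sum>\<mu>\<in>multi_indices d (\<Sum>i=1..d. \<nu> i). c \<mu> * kraw_hat d \<rho> N \<mu> \<alpha>)))"

definition rho_hat :: "(nat \<Rightarrow> real) \<Rightarrow> nat \<Rightarrow> real" where
  "rho_hat \<rho> j =
     \<rho> 1 * \<rho> (j + 1) /
     ((1 - \<rho> 1) * (1 + \<rho> 1 - (\<Sum>i=1..j + 1. \<rho> i)) * (1 + \<rho> 1 - (\<Sum>i=1..j. \<rho> i)))"

definition rho_tilde :: "nat \<Rightarrow> (nat \<Rightarrow> real) \<Rightarrow> nat \<Rightarrow> real" where
  "rho_tilde d \<rho> j =
     \<rho> 1 * \<rho> (d + 1 - j) * (1 - (\<Sum>i=1..d. \<rho> i)) /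
     ((1 - (\<Sum>i=1..d - j. \<rho> i)) * (1 - (\<Sum>i=1..d + 1 - j. \<rho> i)) *
      (1 + \<rho> 1 - (\<Sum>i=1..d. \<rho> i)))"

end

theory Submission
  imports Defs "HOL-Computational_Algebra.Formal_Power_Series"
begin

text \<open>
Put \<open>q\<^sub>j = 1 - \<rho>\<^sub>1 - \<dots> - \<rho>\<^sub>j\<close>, \<open>S\<^sub>j = s\<^sub>1 + \<dots> + s\<^sub>j\<close> and \<open>z\<^sub>j = q\<^bsub>j-1\<^esub> / \<rho>\<^sub>j\<close>.  Up to a factor that depends only
on \<open>\<nu>\<close> and \<open>N\<close>, the polynomial \<open>K\<^sub>\<nu>(x; \<rho>, N)\<close> is the coefficient of \<open>s\<^sup>\<nu>\<close> in
\<open>\<Prod>\<^sub>j (1 + l\<^sub>j(s))\<^bsup>x\<^sub>j\<^esup> \<cdot> (1 + S\<^sub>p)\<^bsup>N - |x|\<^esup>\<close>, where \<open>l\<^sub>j(s) = S\<^bsub>j-1\<^esub> + (1 - z\<^sub>j) s\<^sub>j\<close>: the product formula in its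
definition arises by extracting one variable \<open>s\<^sub>j\<close> at a time.  Inserting a scalar \<open>t\<close> in front of
each linear form, this holds for all real \<open>x\<close> and \<open>N\<close> as an identity of power series in the single
variable \<open>t\<close> (\<open>kcoef_generating_function\<close>); for lattice points it is an identity of
polynomials (\<open>kcoef_generating_function_grid\<close>).  Three consequences are used.

Norms.  Summing the product of two such generating functions, in \<open>s\<close> and in \<open>t\<close>, against the weight
gives, by the multinomial theorem, the \<open>N\<close>-th power of a bilinear form in \<open>(1, s)\<close> and \<open>(1, t)\<close>.  This
form turns out to be diagonal, with coefficients \<open>c\<^sub>j = q\<^sub>j q\<^bsub>j-1\<^esub> / \<rho>\<^sub>j\<close>.  Comparing coefficients proves
orthogonality and computes the norms (\<open>kcoef_orthogonality\<close>, \<open>kraw_hat_eq_kcoef\<close>); orthogonality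
also makes the connection coefficients unique.

Duality.  Summing the generating function over \<open>x\<close> against multinomial coefficients and monomials
\<open>y\<^sup>x\<close> gives the \<open>N\<close>-th power of another bilinear form, in \<open>y\<close> and \<open>s\<close>.  With \<open>s\<^sub>0 = y\<^bsub>p+1\<^esub> = 1\<close> it consists of the terms
\<open>y\<^sub>j s\<^sub>i\<close> for \<open>i < j\<close> and \<open>(1 - z\<^sub>j) y\<^sub>j s\<^sub>j\<close>, and a form of this shape results again when the two variables
are exchanged and reversed.  So \<open>x\<close> and \<open>\<nu>\<close> may be exchanged,
at the price of reversing them and of replacing \<open>\<rho>\<close> by a dual parameter (\<open>kraw_hat_duality\<close>).

Connection.  Permuting \<open>\<alpha>\<close> and \<open>\<rho>\<close> permutes the factors of the generating function.  The \<open>d + 1\<close>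
linear forms for \<open>\<tau>\<rho>\<close>, in the variables \<open>s\<close>, are the permuted forms for \<open>\<rho>\<close> in variables \<open>u = R s\<close>
for a \<open>d \<times> d\<close> matrix \<open>R\<close>, so the unnormalized connection coefficient is the coefficient of \<open>s\<^sup>\<nu>\<close> in
\<open>(R s)\<^sup>\<mu>\<close>; in particular \<open>N\<close> has disappeared.  For the cyclic permutation \<open>R\<close> can be written down,
and after rescaling its rows are the linear forms of the \<open>(d - 1)\<close>-variable Krawtchouk polynomials
with parameter \<open>\<rho>\<close>-tilde, in reversed order.  Hence \<open>(R s)\<^sup>\<mu>\<close> is itself a Krawtchouk generating
function (\<open>conn_form_power_expansion\<close>, \<open>kcoef_connection\<close>).  Bookkeeping of the norms gives the
second formula, and since \<open>\<rho>\<close>-hat is the dual parameter of \<open>\<rho>\<close>-tilde, duality turns it into the first.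
\<close>

unbundle no vec_syntax
unbundle fps_syntax

section \<open>Univariate Krawtchouk factors\<close>

text \<open>
This is the coefficient of \<open>u\<^sup>m\<close> in \<open>(1 + (1 - z) u)\<^sup>x (1 + u)\<^bsup>M - x\<^esup> = (1 + u)\<^sup>M (1 - z u / (1 + u))\<^sup>x\<close>,
expanded in powers of \<open>z\<close>; \<open>M\<close> and \<open>x\<close> are arbitrary reals.
\<close>
definition kfac :: "nat \<Rightarrow> real \<Rightarrow> real \<Rightarrow> real \<Rightarrow> real" where
  "kfac m x M z = (\<Sum>k\<le>m. (x gchoose k) * (- z) ^ k * ((M - real k) gchoose (m - k)))"

lemma pochhammer_uminus_gbinomial:
  "pochhammer (- x) k = (- 1) ^ k * fact k * (x gchoose k)" for x :: real
  by (simp add: gbinomial_pochhammer)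

lemma pochhammer_2F1_eq_kfac:
  "pochhammer_2F1 m x c z = (- 1) ^ m * fact m * kfac m x (- c) z"
proof -
  have "pochhammer (- real m) k * pochhammer (- x) k / fact k * pochhammer (c + real k) (m - k) * z ^ k
      = (- 1) ^ m * fact m * ((x gchoose k) * (- z) ^ k * ((- c - real k) gchoose (m - k)))"
    if "k \<le> m" for k
  proof -
    have 1: "pochhammer (- real m) k = (- 1) ^ k * (fact m / fact (m - k))"
      using that by (simp add: pochhammer_uminus_gbinomial binomial_gbinomial[symmetric] binomial_fact)
    have 2: "pochhammer (c + real k) (m - k) = (- 1) ^ (m - k) * fact (m - k) * ((- c - real k) gchoose (m - k))"
      using pochhammer_uminus_gbinomial[of "- c - real k" "m - k"] by (simp add: add.commute)
    have 3: "(- 1 :: real) ^ m = (- 1) ^ (m - k) * (- 1) ^ k"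
      using that by (simp flip: power_add)
    have 4: "(- z) ^ k = (- 1) ^ k * z ^ k" by (simp flip: power_mult_distrib)
    show ?thesis
      unfolding 1 2 3 4 pochhammer_uminus_gbinomial[of x k] by (simp add: field_simps)
  qed
  then show ?thesis
    unfolding pochhammer_2F1_def kfac_def atLeast0AtMost sum_distrib_left by (intro sum.cong) auto
qed

text \<open>
The binomial series of \<open>(1 + \<beta> t)\<^sup>y\<close> in the variable \<open>t\<close>.
\<close>
definition bpow :: "real \<Rightarrow> real \<Rightarrow> real fps" where
  "bpow \<beta> y = Abs_fps (\<lambda>n. (y gchoose n) * \<beta> ^ n)"

lemma bpow_nth [simp]: "fps_nth (bpow \<beta> y) n = (y gchoose n) * \<beta> ^ n"
  by (simp add: bpow_def)

lemma bpow_0 [simp]: "bpow \<beta> 0 = 1"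
  by (rule fps_ext) (auto simp: gbinomial_0_left)

lemma bpow_add: "bpow \<beta> (x + y) = bpow \<beta> x * bpow \<beta> y"
proof (rule fps_ext)
  fix n
  have "(\<Sum>i=0..n. (x gchoose i) * \<beta> ^ i * ((y gchoose (n - i)) * \<beta> ^ (n - i))) =
        (\<Sum>i=0..n. (x gchoose i) * (y gchoose (n - i))) * \<beta> ^ n"
    unfolding sum_distrib_right by (intro sum.cong) (auto simp flip: power_add)
  then show "bpow \<beta> (x + y) $ n = (bpow \<beta> x * bpow \<beta> y) $ n"
    by (simp add: fps_mult_nth gbinomial_Vandermonde)
qed

lemma sum_triangle_swap:
  fixes g :: "nat \<Rightarrow> nat \<Rightarrow> 'a :: comm_monoid_add"
  shows "(\<Sum>k\<le>n. \<Sum>i\<le>n - k. g k i) = (\<Sum>l\<le>n. \<Sum>k\<le>l. g k (l - k))"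
  unfolding sum.Sigma[OF finite_atMost ballI[OF finite_atMost]]
  by (rule sum.reindex_bij_witness[of _ "\<lambda>(l, k). (k, l - k)" "\<lambda>(k, i). (k + i, k)"]) auto

text \<open>
The coefficient of \<open>t\<^sup>n\<close> in the expansion of \<open>((1 + \<beta> t) + \<alpha> t)\<^sup>x (1 + \<beta> t)\<^sup>y\<close> by powers of \<open>\<alpha> t\<close>.  No
composition of series is involved: the coefficients of \<open>t\<^sup>l\<close> in the first factor agree by trinomial revision and the
ordinary binomial theorem for \<open>(\<alpha> + \<beta>)\<^sup>l\<close>.
\<close>
lemma bpow_binomial_theorem:
  "(\<Sum>k\<le>n. (x gchoose k) * \<alpha> ^ k * (bpow \<beta> (x + y - real k) $ (n - k))) =
   (bpow (\<beta> + \<alpha>) x * bpow \<beta> y) $ n"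
proof -
  have *: "(\<Sum>k\<le>l. (x gchoose k) * \<alpha> ^ k * (((x - real k) gchoose (l - k)) * \<beta> ^ (l - k)))
      = (x gchoose l) * (\<beta> + \<alpha>) ^ l" for l
  proof -
    have "(x gchoose k) * \<alpha> ^ k * (((x - real k) gchoose (l - k)) * \<beta> ^ (l - k)) =
          (x gchoose l) * (of_nat (l choose k) * \<alpha> ^ k * \<beta> ^ (l - k))" if "k \<le> l" for k
      using gbinomial_trinomial_revision[OF that, of x] by (simp add: binomial_gbinomial)
    then show ?thesis
      unfolding add.commute[of \<beta>] binomial_ring sum_distrib_left by (intro sum.cong) auto
  qed
  have "(\<Sum>k\<le>n. (x gchoose k) * \<alpha> ^ k * (bpow \<beta> (x + y - real k) $ (n - k))) =
    (\<Sum>k\<le>n. \<Sum>i\<le>n - k. (x gchoose k) * \<alpha> ^ k * (((x - real k) gchoose i) * \<beta> ^ i) * (bpow \<beta> y $ (n - (k + i))))"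
  proof (intro sum.cong refl)
    fix k
    have "bpow \<beta> (x + y - real k) = bpow \<beta> (x - real k) * bpow \<beta> y"
      by (simp flip: bpow_add add: algebra_simps)
    then show "(x gchoose k) * \<alpha> ^ k * (bpow \<beta> (x + y - real k) $ (n - k)) =
       (\<Sum>i\<le>n - k. (x gchoose k) * \<alpha> ^ k * (((x - real k) gchoose i) * \<beta> ^ i) * (bpow \<beta> y $ (n - (k + i))))"
      by (simp add: fps_mult_nth atLeast0AtMost sum_distrib_left mult.assoc)
  qed
  also have "\<dots> = (\<Sum>l\<le>n. \<Sum>k\<le>l. (x gchoose k) * \<alpha> ^ k * (((x - real k) gchoose (l - k)) * \<beta> ^ (l - k)) * (bpow \<beta> y $ (n - (k + (l - k)))))"
    by (rule sum_triangle_swap)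
  also have "\<dots> = (\<Sum>l\<le>n. (\<Sum>k\<le>l. (x gchoose k) * \<alpha> ^ k * (((x - real k) gchoose (l - k)) * \<beta> ^ (l - k))) * (bpow \<beta> y $ (n - l)))"
    unfolding sum_distrib_right by (intro sum.cong) auto
  also have "\<dots> = (bpow (\<beta> + \<alpha>) x * bpow \<beta> y) $ n"
    unfolding * by (simp add: fps_mult_nth atLeast0AtMost)
  finally show ?thesis .
qed

text \<open>
Summing \<open>kfac\<close> over its degree against \<open>(s t)\<^sup>m (1 + S t)\<^bsup>M - m\<^esup>\<close> produces two powers of linear
polynomials in \<open>t\<close>.  The factor \<open>(1 + S t)\<^bsup>M - m\<^esup>\<close>, whose exponent depends on \<open>m\<close>, is what remains of the
variables eliminated earlier.  Expanding \<open>kfac\<close> in powers of \<open>z\<close>, the binomial theorem is applied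
once to collect \<open>S + s\<close> and once more to collect \<open>S + s - z s\<close>.
\<close>
lemma kfac_generating_function:
  "(\<Sum>m\<le>n. kfac m x M z * s ^ m * (bpow S (M - real m) $ (n - m))) =
   (bpow (S + (1 - z) * s) x * bpow (S + s) (M - x)) $ n"
proof -
  have "(\<Sum>m\<le>n. kfac m x M z * s ^ m * (bpow S (M - real m) $ (n - m))) =
     (\<Sum>m\<le>n. \<Sum>k\<le>m. (x gchoose k) * (- z * s) ^ k *
        (((M - real k) gchoose (m - k)) * s ^ (m - k) * (bpow S (M - real k - real (m - k)) $ (n - k - (m - k)))))"
    unfolding kfac_def sum_distrib_right
  proof (intro sum.cong refl)
    fix m k :: nat assume "k \<in> {..m}"
    then have k: "s ^ m = s ^ k * s ^ (m - k)" "real (m - k) = real m - real k" "k + (m - k) = m"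
      by (simp_all flip: power_add)
    show "(x gchoose k) * (- z) ^ k * ((M - real k) gchoose (m - k)) * s ^ m * (bpow S (M - real m) $ (n - m)) =
      (x gchoose k) * (- z * s) ^ k *
        (((M - real k) gchoose (m - k)) * s ^ (m - k) * (bpow S (M - real k - real (m - k)) $ (n - k - (m - k))))"
      unfolding k(1,2) power_mult_distrib diff_diff_left k(3) by simp
  qed
  also have "\<dots> = (\<Sum>k\<le>n. \<Sum>i\<le>n - k. (x gchoose k) * (- z * s) ^ k *
        (((M - real k) gchoose i) * s ^ i * (bpow S (M - real k - real i) $ (n - k - i))))"
    by (rule sum_triangle_swap[symmetric])
  also have "\<dots> = (\<Sum>k\<le>n. (x gchoose k) * (- z * s) ^ k * (bpow (S + s) (x + (M - x) - real k) $ (n - k)))"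
  proof (intro sum.cong refl)
    fix k
    show "(\<Sum>i\<le>n - k. (x gchoose k) * (- z * s) ^ k *
        (((M - real k) gchoose i) * s ^ i * (bpow S (M - real k - real i) $ (n - k - i)))) =
      (x gchoose k) * (- z * s) ^ k * (bpow (S + s) (x + (M - x) - real k) $ (n - k))"
      using bpow_binomial_theorem[of "M - real k" s S 0 "n - k"]
      by (simp flip: sum_distrib_left add: mult.assoc)
  qed
  also have "\<dots> = (bpow (S + s + - z * s) x * bpow (S + s) (M - x)) $ n"
    by (rule bpow_binomial_theorem)
  finally show ?thesis by (simp add: algebra_simps)
qed

section \<open>Sums over multi-indices\<close>

lemma sum_multi_indices_0:
  "(\<Sum>\<nu>\<in>multi_indices 0 n. f \<nu>) = (if n = 0 then f (\<lambda>_. 0) else 0)"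
proof -
  have "multi_indices 0 n = (if n = 0 then {\<lambda>_. 0} else {})"
    by (auto simp: multi_indices_def)
  then show ?thesis by simp
qed

lemma multi_indices_Suc:
  "bij_betw (\<lambda>(m, \<nu>). \<nu>(Suc p := m)) (SIGMA m:{..n}. multi_indices p (n - m)) (multi_indices (Suc p) n)"
proof (rule bij_betwI[where g = "\<lambda>\<nu>. (\<nu> (Suc p), \<nu>(Suc p := 0))"])
  show "(\<lambda>(m, \<nu>). \<nu>(Suc p := m)) \<in> (SIGMA m:{..n}. multi_indices p (n - m)) \<rightarrow> multi_indices (Suc p) n"
    by (auto simp: multi_indices_def)
  show "(\<lambda>\<nu>. (\<nu> (Suc p), \<nu>(Suc p := 0))) \<in> multi_indices (Suc p) n \<rightarrow> (SIGMA m:{..n}. multi_indices p (n - m))"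
    by (auto simp: multi_indices_def)
  show "(\<lambda>\<nu>. (\<nu> (Suc p), \<nu>(Suc p := 0))) ((\<lambda>(m, \<nu>). \<nu>(Suc p := m)) x) = x"
    if "x \<in> (SIGMA m:{..n}. multi_indices p (n - m))" for x
    using that by (auto simp: multi_indices_def fun_eq_iff)
  show "(\<lambda>(m, \<nu>). \<nu>(Suc p := m)) ((\<lambda>\<nu>. (\<nu> (Suc p), \<nu>(Suc p := 0))) y) = y"
    if "y \<in> multi_indices (Suc p) n" for y
    by auto
qed

lemma finite_multi_indices [simp]: "finite (multi_indices p n)"
proof (induction p arbitrary: n)
  case 0
  have "multi_indices 0 n \<subseteq> {\<lambda>_. 0}" by (auto simp: multi_indices_def)
  then show ?case by (rule finite_subset) simp
next
  case (Suc p)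
  show ?case
    using bij_betw_finite[OF multi_indices_Suc[of p n]] Suc by auto
qed

lemma sum_multi_indices_Suc:
  "(\<Sum>\<nu>\<in>multi_indices (Suc p) n. f \<nu>) = (\<Sum>m\<le>n. \<Sum>\<nu>\<in>multi_indices p (n - m). f (\<nu>(Suc p := m)))"
  using sum.reindex_bij_betw[OF multi_indices_Suc[of p n], of f]
  by (simp add: sum.Sigma case_prod_beta)

lemma sum_grid: "(\<Sum>\<nu>\<in>grid p N. f \<nu>) = (\<Sum>n\<le>N. \<Sum>\<nu>\<in>multi_indices p n. f \<nu>)"
proof -
  have "grid p N = (\<Union>n\<in>{..N}. multi_indices p n)"
    by (auto simp: grid_def multi_indices_def)
  moreover have "multi_indices p m \<inter> multi_indices p n = {}" if "m \<noteq> n" for m n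
    using that by (auto simp: multi_indices_def)
  ultimately show ?thesis
    by (simp add: sum.UNION_disjoint)
qed

lemma finite_grid [simp]: "finite (grid p N)"
proof -
  have "grid p N = (\<Union>n\<in>{..N}. multi_indices p n)"
    by (auto simp: grid_def multi_indices_def)
  then show ?thesis by simp
qed

lemma bij_betw_grid_Suc:
  "bij_betw (\<lambda>(m, \<nu>). \<nu>(Suc p := m)) (SIGMA m:{..N}. grid p (N - m)) (grid (Suc p) N)"
proof (rule bij_betwI[where g = "\<lambda>\<nu>. (\<nu> (Suc p), \<nu>(Suc p := 0))"])
  show "(\<lambda>(m, \<nu>). \<nu>(Suc p := m)) ((\<lambda>\<nu>. (\<nu> (Suc p), \<nu>(Suc p := 0))) y) = y" for y
    by auto
qed (auto simp: grid_def fun_eq_iff)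

lemma sum_grid_Suc:
  "(\<Sum>\<nu>\<in>grid (Suc p) N. f \<nu>) = (\<Sum>m\<le>N. \<Sum>\<nu>\<in>grid p (N - m). f (\<nu>(Suc p := m)))"
  using sum.reindex_bij_betw[OF bij_betw_grid_Suc[of p N], of f]
  by (simp add: sum.Sigma case_prod_beta)

lemma bij_betw_grid_multi_indices:
  "bij_betw (\<lambda>\<nu>. \<nu>(Suc p := n - (\<Sum>i=1..p. \<nu> i))) (grid p n) (multi_indices (Suc p) n)"
proof (rule bij_betwI[where g = "\<lambda>\<nu>. \<nu>(Suc p := 0)"])
  show "(\<lambda>\<nu>. \<nu>(Suc p := n - (\<Sum>i=1..p. \<nu> i))) ((\<lambda>\<nu>. \<nu>(Suc p := 0)) y) = y" if "y \<in> multi_indices (Suc p) n" for y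
    using that by (auto simp: multi_indices_def fun_eq_iff)
qed (auto simp: grid_def multi_indices_def fun_eq_iff)

lemma sum_multi_indices_grid:
  "(\<Sum>\<nu>\<in>multi_indices (Suc p) n. f \<nu>) = (\<Sum>\<nu>\<in>grid p n. f (\<nu>(Suc p := n - (\<Sum>i=1..p. \<nu> i))))"
  using sum.reindex_bij_betw[OF bij_betw_grid_multi_indices, of f p n] by simp

section \<open>The generating function\<close>

text \<open>
\<open>K\<^sub>\<nu>(x; \<rho>, N)\<close> without its normalizing factor, with \<open>z\<^sub>j\<close> in place of
\<open>(1 - |\<rho>\<^bsub>j-1\<^esub>|) / \<rho>\<^sub>j\<close>.  Taking \<open>N\<close> real makes the removal of the last variable, which lowers \<open>N\<close> by
the last entry of \<open>\<nu>\<close>, possible without a case distinction.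
\<close>
definition kcoef :: "nat \<Rightarrow> (nat \<Rightarrow> real) \<Rightarrow> real \<Rightarrow> (nat \<Rightarrow> nat) \<Rightarrow> (nat \<Rightarrow> real) \<Rightarrow> real" where
  "kcoef p z N \<nu> x =
     (\<Prod>j=1..p. kfac (\<nu> j) (x j) (N - (\<Sum>i\<in>{1..<j}. x i) - real (\<Sum>i\<in>{j<..p}. \<nu> i)) (z j))"

lemma kcoef_Suc:
  "kcoef (Suc p) z N (\<nu>(Suc p := m)) x =
   kfac m (x (Suc p)) (N - (\<Sum>i=1..p. x i)) (z (Suc p)) * kcoef p z (N - real m) \<nu> x"
proof -
  have 1: "{1..<Suc p} = {1..p}" "{Suc p<..Suc p} = {}" by auto
  have 2: "(\<Sum>i\<in>{j<..Suc p}. (\<nu>(Suc p := m)) i) = (\<Sum>i\<in>{j<..p}. \<nu> i) + m" if "j \<le> p" for j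
  proof -
    have "{j<..Suc p} = insert (Suc p) {j<..p}" using that by auto
    moreover have "(\<Sum>i\<in>{j<..p}. (\<nu>(Suc p := m)) i) = (\<Sum>i\<in>{j<..p}. \<nu> i)"
      by (intro sum.cong) auto
    ultimately show ?thesis by simp
  qed
  show ?thesis
    unfolding kcoef_def prod.nat_ivl_Suc'[of 1 p, OF le_add2[of 1 p, unfolded Suc_eq_plus1[symmetric]]]
    unfolding 1
    by (intro arg_cong2[where f = "(*)"] prod.cong refl)
       (auto simp: 2 algebra_simps fun_upd_same fun_upd_other simp del: of_nat_sum fun_upd_apply)
qed

text \<open>
Only the last factor of \<open>kcoef\<close> involves the last entry of \<open>x\<close>, and the last entry \<open>m\<close> of \<open>\<nu>\<close> affects the
other factors only through \<open>N - m\<close>.  So the induction hypothesis at \<open>N - m\<close> leaves a sum over \<open>m\<close> of the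
shape treated in \<open>kfac_generating_function\<close>.
\<close>
theorem kcoef_generating_function:
  "(\<Sum>\<nu>\<in>multi_indices p n. kcoef p z N \<nu> x * (\<Prod>i=1..p. s i ^ \<nu> i)) =
   ((\<Prod>j=1..p. bpow ((\<Sum>i\<in>{1..<j}. s i) + (1 - z j) * s j) (x j)) *
      bpow (\<Sum>i=1..p. s i) (N - (\<Sum>i=1..p. x i))) $ n"
proof (induction p arbitrary: N n)
  case 0
  show ?case unfolding sum_multi_indices_0 by (simp add: kcoef_def power_0_left)
next
  case (Suc p)
  let ?Q = "\<Prod>j=1..p. bpow ((\<Sum>i\<in>{1..<j}. s i) + (1 - z j) * s j) (x j)"
  let ?S = "\<Sum>i=1..p. s i"
  let ?M = "N - (\<Sum>i=1..p. x i)"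
  let ?h = "\<lambda>m. kfac m (x (Suc p)) ?M (z (Suc p))"
  let ?T = "bpow (?S + (1 - z (Suc p)) * s (Suc p)) (x (Suc p)) * bpow (?S + s (Suc p)) (?M - x (Suc p))"
  have "(\<Sum>\<nu>\<in>multi_indices (Suc p) n. kcoef (Suc p) z N \<nu> x * (\<Prod>i=1..Suc p. s i ^ \<nu> i)) =
    (\<Sum>m\<le>n. \<Sum>\<nu>\<in>multi_indices p (n - m). ?h m * s (Suc p) ^ m *
        (kcoef p z (N - real m) \<nu> x * (\<Prod>i=1..p. s i ^ \<nu> i)))"
    unfolding sum_multi_indices_Suc
  proof (intro sum.cong refl)
    fix m \<nu>
    have "(\<Prod>i=1..p. s i ^ (\<nu>(Suc p := m)) i) = (\<Prod>i=1..p. s i ^ \<nu> i)"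
      by (intro prod.cong) auto
    then show "kcoef (Suc p) z N (\<nu>(Suc p := m)) x * (\<Prod>i=1..Suc p. s i ^ (\<nu>(Suc p := m)) i) =
      ?h m * s (Suc p) ^ m * (kcoef p z (N - real m) \<nu> x * (\<Prod>i=1..p. s i ^ \<nu> i))"
      unfolding kcoef_Suc by (simp add: prod.nat_ivl_Suc')
  qed
  also have "\<dots> = (\<Sum>m\<le>n. ?h m * s (Suc p) ^ m * ((?Q * bpow ?S (?M - real m)) $ (n - m)))"
    unfolding sum_distrib_left[symmetric] Suc by (simp only: cancel_ab_semigroup_add_class.diff_right_commute[of N _ "sum x {1..p}"])
  also have "\<dots> = (\<Sum>m\<le>n. \<Sum>i\<le>n - m. ?h m * s (Suc p) ^ m * (bpow ?S (?M - real m) $ i) * (?Q $ (n - (m + i))))"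
    unfolding mult.commute[of ?Q] fps_mult_nth[of "bpow _ _"] atLeast0AtMost sum_distrib_left
    by (simp add: mult_ac)
  also have "\<dots> = (\<Sum>l\<le>n. \<Sum>m\<le>l. ?h m * s (Suc p) ^ m * (bpow ?S (?M - real m) $ (l - m)) * (?Q $ (n - (m + (l - m)))))"
    by (rule sum_triangle_swap)
  also have "\<dots> = (\<Sum>l\<le>n. (\<Sum>m\<le>l. ?h m * s (Suc p) ^ m * (bpow ?S (?M - real m) $ (l - m))) * (?Q $ (n - l)))"
    unfolding sum_distrib_right by (intro sum.cong) auto
  also have "\<dots> = (?T * ?Q) $ n"
    unfolding kfac_generating_function by (simp only: fps_mult_nth[of ?T ?Q n] atLeast0AtMost)
  \<comment> \<open>here \<open>?Q\<close> collects the factors with \<open>j \<le> p\<close> and \<open>?T\<close> the two new ones\<close>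
  also have "?T * ?Q = (\<Prod>j=1..Suc p. bpow ((\<Sum>i\<in>{1..<j}. s i) + (1 - z j) * s j) (x j)) *
      bpow (\<Sum>i=1..Suc p. s i) (N - (\<Sum>i=1..Suc p. x i))"
  proof -
    have "{1..<Suc p} = {1..p}" by auto
    then show ?thesis by (simp add: prod.nat_ivl_Suc' algebra_simps)
  qed
  finally show ?case .
qed

lemma degree_linear_power_le: "degree ([:a, b:] ^ k) \<le> k" for a b :: real
  using degree_power_le[of "[:a, b:]" k] by (rule order_trans) auto

lemma bpow_of_nat: "bpow \<beta> (real k) = fps_of_poly ([:1, \<beta>:] ^ k)"
proof (rule fps_ext)
  fix n
  show "bpow \<beta> (real k) $ n = fps_of_poly ([:1, \<beta>:] ^ k) $ n"
  proof (cases "n \<le> k")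
    case True
    then show ?thesis by (simp add: coeff_linear_poly_power binomial_gbinomial)
  next
    case False
    then show ?thesis
      using degree_linear_power_le[of 1 \<beta> k] by (simp add: coeff_eq_0 binomial_gbinomial[symmetric])
  qed
qed

text \<open>
For a lattice point the power series of the generating function is a polynomial in \<open>t\<close> of degree at most
\<open>N\<close>, and its coefficients up to \<open>N\<close> add up to its value at \<open>t = 1\<close>.
\<close>
lemma kcoef_generating_function_grid:
  assumes "(\<Sum>i=1..p. x i) \<le> N"
  shows "(\<Sum>\<nu>\<in>grid p N. kcoef p z (real N) \<nu> (\<lambda>i. real (x i)) * (\<Prod>i=1..p. s i ^ \<nu> i)) =
    (\<Prod>j=1..p. (1 + (\<Sum>i\<in>{1..<j}. s i) + (1 - z j) * s j) ^ x j) *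
      (1 + (\<Sum>i=1..p. s i)) ^ (N - (\<Sum>i=1..p. x i))"
proof -
  define Q :: "real poly" where "Q = (\<Prod>j=1..p. [:1, (\<Sum>i\<in>{1..<j}. s i) + (1 - z j) * s j:] ^ x j) *
      [:1, (\<Sum>i=1..p. s i):] ^ (N - (\<Sum>i=1..p. x i))"
  have "degree Q \<le> (\<Sum>j=1..p. x j) + (N - (\<Sum>i=1..p. x i))"
    unfolding Q_def
    by (intro order_trans[OF degree_mult_le] add_mono degree_linear_power_le order_trans[OF degree_prod_sum_le] sum_mono) (auto simp: degree_linear_power_le)
  then have "degree Q \<le> N" using assms by simp
  have "(\<Sum>\<nu>\<in>grid p N. kcoef p z (real N) \<nu> (\<lambda>i. real (x i)) * (\<Prod>i=1..p. s i ^ \<nu> i)) = (\<Sum>n\<le>N. coeff Q n)"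
    unfolding sum_grid kcoef_generating_function
  proof (intro sum.cong refl)
    fix n
    have "real N - (\<Sum>i=1..p. real (x i)) = real (N - (\<Sum>i=1..p. x i))"
      using assms by (simp add: of_nat_diff)
    then show "((\<Prod>j=1..p. bpow ((\<Sum>i\<in>{1..<j}. s i) + (1 - z j) * s j) (real (x j))) *
      bpow (\<Sum>i=1..p. s i) (real N - (\<Sum>i=1..p. real (x i)))) $ n = coeff Q n"
      unfolding Q_def by (simp only: bpow_of_nat fps_of_poly_mult[symmetric] fps_of_poly_prod[symmetric] fps_of_poly_nth)
  qed
  also have "\<dots> = poly Q 1"
    using \<open>degree Q \<le> N\<close> unfolding poly_altdef
    by (intro sum.mono_neutral_cong_right) (auto simp: coeff_eq_0)
  finally show ?thesis by (simp add: Q_def poly_prod algebra_simps)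
qed

section \<open>Monomials and the multinomial theorem\<close>

text \<open>
Two expansions over the same simplex of exponents can be compared coefficientwise.  The induction
reads the sum as a polynomial in the last variable.
\<close>
lemma monomials_independent:
  fixes b :: "(nat \<Rightarrow> nat) \<Rightarrow> real"
  assumes "\<And>s. (\<Sum>\<nu>\<in>grid p N. b \<nu> * (\<Prod>i=1..p. s i ^ \<nu> i)) = 0" "\<nu> \<in> grid p N"
  shows "b \<nu> = 0"
  using assms
proof (induction p arbitrary: N b \<nu>)
  case 0
  have "grid 0 N = {\<lambda>_. 0}" by (auto simp: grid_def)
  then show ?case using 0 by simp
next
  case (Suc p)
  define m where "m = \<nu> (Suc p)"
  have \<nu>: "\<nu> = (\<nu>(Suc p := 0))(Suc p := m)" by (simp add: m_def)
  have m: "m \<le> N" "\<nu>(Suc p := 0) \<in> grid p (N - m)"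
    using Suc.prems(2) by (auto simp: grid_def m_def)
  have "(\<Sum>\<nu>\<in>grid p (N - m). b (\<nu>(Suc p := m)) * (\<Prod>i=1..p. s i ^ \<nu> i)) = 0" for s
  proof -
    have "(\<Sum>m\<le>N. (\<Sum>\<nu>\<in>grid p (N - m). b (\<nu>(Suc p := m)) * (\<Prod>i=1..p. s i ^ \<nu> i)) * y ^ m) = 0" for y
    proof -
      have "(\<Prod>i=1..Suc p. (s(Suc p := y)) i ^ (\<nu>(Suc p := m)) i) = (\<Prod>i=1..p. s i ^ \<nu> i) * y ^ m" for \<nu> m
      proof -
        have "(\<Prod>i=1..p. (s(Suc p := y)) i ^ (\<nu>(Suc p := m)) i) = (\<Prod>i=1..p. s i ^ \<nu> i)"
          by (intro prod.cong) auto
        then show ?thesis by (simp add: prod.nat_ivl_Suc')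
      qed
      then show ?thesis
        using Suc.prems(1)[of "s(Suc p := y)"]
        unfolding sum_grid_Suc by (simp only: sum_distrib_right mult.assoc)
    qed
    then show ?thesis using polyfun_eq_0[of "\<lambda>m. \<Sum>\<nu>\<in>grid p (N - m). b (\<nu>(Suc p := m)) * (\<Prod>i=1..p. s i ^ \<nu> i)" N] m(1)
      by auto
  qed
  from Suc.IH[where N = "N - m" and b = "\<lambda>\<nu>. b (\<nu>(Suc p := m))", OF this m(2)] show ?case
    by (simp only: \<nu>[symmetric])
qed

corollary monomials_coeff_eq:
  fixes a b :: "(nat \<Rightarrow> nat) \<Rightarrow> real"
  assumes "\<And>s. (\<Sum>\<nu>\<in>grid p N. a \<nu> * (\<Prod>i=1..p. s i ^ \<nu> i)) = (\<Sum>\<nu>\<in>grid p N. b \<nu> * (\<Prod>i=1..p. s i ^ \<nu> i))"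
    and "\<nu> \<in> grid p N"
  shows "a \<nu> = b \<nu>"
  using monomials_independent[where p = p and N = N and b = "\<lambda>\<nu>. a \<nu> - b \<nu>"] assms
  by (simp add: algebra_simps sum_subtractf)

definition multinom :: "nat \<Rightarrow> nat \<Rightarrow> (nat \<Rightarrow> nat) \<Rightarrow> real" where
  "multinom p N x = fact N / ((\<Prod>i=1..p. fact (x i)) * fact (N - (\<Sum>i=1..p. x i)))"

lemma multinom_pos: "multinom p N x > 0"
  by (auto simp: multinom_def intro!: divide_pos_pos mult_pos_pos prod_pos)

lemma multinomial_theorem_homogeneous:
  fixes y :: "nat \<Rightarrow> real"
  shows "(\<Sum>x\<in>multi_indices p n. fact n / (\<Prod>i=1..p. fact (x i)) * (\<Prod>i=1..p. y i ^ x i)) = (\<Sum>i=1..p. y i) ^ n"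
proof (induction p arbitrary: n)
  case 0
  show ?case unfolding sum_multi_indices_0 by (simp add: power_0_left)
next
  case (Suc p)
  have "(\<Sum>x\<in>multi_indices (Suc p) n. fact n / (\<Prod>i=1..Suc p. fact (x i)) * (\<Prod>i=1..Suc p. y i ^ x i)) =
    (\<Sum>m\<le>n. \<Sum>x\<in>multi_indices p (n - m). real (n choose m) * y (Suc p) ^ m *
       (fact (n - m) / (\<Prod>i=1..p. fact (x i)) * (\<Prod>i=1..p. y i ^ x i)))"
    unfolding sum_multi_indices_Suc
  proof (intro sum.cong refl)
    fix m x assume "m \<in> {..n}"
    then have b: "real (n choose m) = fact n / (fact m * fact (n - m))"
      by (simp add: binomial_fact)
    have 1: "(\<Prod>i=1..p. fact ((x(Suc p := m)) i)) = (\<Prod>i=1..p. fact (x i) :: real)"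
      by (intro prod.cong) auto
    have 2: "(\<Prod>i=1..p. y i ^ (x(Suc p := m)) i) = (\<Prod>i=1..p. y i ^ x i)"
      by (intro prod.cong) auto
    show "fact n / (\<Prod>i=1..Suc p. fact ((x(Suc p := m)) i)) * (\<Prod>i=1..Suc p. y i ^ (x(Suc p := m)) i) =
       real (n choose m) * y (Suc p) ^ m * (fact (n - m) / (\<Prod>i=1..p. fact (x i)) * (\<Prod>i=1..p. y i ^ x i))"
      using 1 2 by (simp add: prod.nat_ivl_Suc' b field_simps)
  qed
  also have "\<dots> = (y (Suc p) + (\<Sum>i=1..p. y i)) ^ n"
    unfolding sum_distrib_left[symmetric] Suc binomial_ring by simp
  finally show ?case by (simp add: add.commute)
qed

lemma multinomial_theorem_grid:
  fixes y :: "nat \<Rightarrow> real"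
  shows "(\<Sum>x\<in>grid p N. multinom p N x * (\<Prod>i=1..p. y i ^ x i) * y0 ^ (N - (\<Sum>i=1..p. x i))) =
    ((\<Sum>i=1..p. y i) + y0) ^ N"
proof -
  have "(\<Sum>x\<in>grid p N. multinom p N x * (\<Prod>i=1..p. y i ^ x i) * y0 ^ (N - (\<Sum>i=1..p. x i))) =
    (\<Sum>n\<le>N. \<Sum>x\<in>multi_indices p n. real (N choose n) * y0 ^ (N - n) *
       (fact n / (\<Prod>i=1..p. fact (x i)) * (\<Prod>i=1..p. y i ^ x i)))"
    unfolding sum_grid
  proof (intro sum.cong refl)
    fix n x assume n: "n \<in> {..N}" and x: "x \<in> multi_indices p n"
    have b: "real (N choose n) = fact N / (fact n * fact (N - n))"
      using n by (simp add: binomial_fact)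
    have "(\<Sum>i=1..p. x i) = n" using x by (simp add: multi_indices_def)
    then show "multinom p N x * (\<Prod>i=1..p. y i ^ x i) * y0 ^ (N - (\<Sum>i=1..p. x i)) =
      real (N choose n) * y0 ^ (N - n) * (fact n / (\<Prod>i=1..p. fact (x i)) * (\<Prod>i=1..p. y i ^ x i))"
      by (simp add: multinom_def b field_simps)
  qed
  also have "\<dots> = ((\<Sum>i=1..p. y i) + y0) ^ N"
    unfolding sum_distrib_left[symmetric] multinomial_theorem_homogeneous binomial_ring
    by (simp add: mult_ac)
  finally show ?thesis .
qed

section \<open>Orthogonality and norms\<close>

lemma kraw_weight_eq:
  "kraw_weight p \<rho> N x = multinom p N x * (\<Prod>i=1..p. \<rho> i ^ x i) * (1 - (\<Sum>i=1..p. \<rho> i)) ^ (N - (\<Sum>i=1..p. x i))"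
  by (simp add: kraw_weight_def multinom_def prod_dividef)

definition kraw_arg :: "(nat \<Rightarrow> real) \<Rightarrow> nat \<Rightarrow> real" where
  "kraw_arg \<rho> j = (1 - (\<Sum>i\<in>{1..<j}. \<rho> i)) / \<rho> j"

lemma kraw_eq_kcoef:
  assumes "(\<Sum>i=1..p. \<nu> i) \<le> N"
  shows "kraw p \<rho> N \<nu> x = kcoef p (kraw_arg \<rho>) (real N) \<nu> x / multinom p N \<nu>"
proof -
  have 1: "pochhammer (- real N) (\<Sum>i=1..p. \<nu> i) = (- 1) ^ (\<Sum>i=1..p. \<nu> i) * (fact N / fact (N - (\<Sum>i=1..p. \<nu> i)))"
    using assms by (simp add: pochhammer_uminus_gbinomial binomial_gbinomial[symmetric] binomial_fact)
  have 2: "(\<Prod>j=1..p. pochhammer_2F1 (\<nu> j) (x j)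
        (- real N + (\<Sum>i\<in>{1..<j}. x i) + real (\<Sum>i\<in>{j<..p}. \<nu> i))
        ((1 - (\<Sum>i\<in>{1..<j}. \<rho> i)) / \<rho> j)) =
     (- 1) ^ (\<Sum>i=1..p. \<nu> i) * (\<Prod>i=1..p. fact (\<nu> i)) * kcoef p (kraw_arg \<rho>) (real N) \<nu> x"
    unfolding kcoef_def pochhammer_2F1_eq_kfac kraw_arg_def power_sum prod.distrib[symmetric]
    by (intro prod.cong refl) (simp add: algebra_simps)
  show ?thesis
    unfolding kraw_def 1 2 by (simp add: multinom_def)
qed

text \<open>
The diagonal coefficient \<open>c\<^sub>j = q\<^sub>j q\<^bsub>j-1\<^esub> / \<rho>\<^sub>j\<close> of the form in \<open>kraw_bilinear_form\<close>; the squared norm of \<open>K\<^sub>\<nu>\<close>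
is \<open>\<Prod>\<^sub>j c\<^sub>j\<^bsup>\<nu>\<^sub>j\<^esup>\<close> divided by a multinomial coefficient.
\<close>
definition kraw_scale :: "(nat \<Rightarrow> real) \<Rightarrow> nat \<Rightarrow> real" where
  "kraw_scale \<rho> j = (1 - (\<Sum>i=1..j. \<rho> i)) * (1 - (\<Sum>i\<in>{1..<j}. \<rho> i)) / \<rho> j"

text \<open>
The linear forms of the generating function, extended by the constant 1, are orthogonal with respect
to the weights \<open>\<rho>\<^sub>1, \<dots>, \<rho>\<^sub>p, 1 - |\<rho>|\<close>.  Splitting off \<open>\<rho>\<^bsub>p+1\<^esub>\<close> from the remaining weight \<open>q\<^sub>p\<close> adds exactly
the term \<open>c\<^bsub>p+1\<^esub> s\<^bsub>p+1\<^esub> t\<^bsub>p+1\<^esub>\<close>, because \<open>\<rho>\<^bsub>p+1\<^esub> (1 - z\<^bsub>p+1\<^esub>) + q\<^bsub>p+1\<^esub> = 0\<close> cancels the mixed terms.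
\<close>
lemma kraw_bilinear_form:
  assumes "\<And>i. i \<in> {1..p} \<Longrightarrow> \<rho> i \<noteq> 0"
  shows "(\<Sum>j=1..p. \<rho> j * (1 + (\<Sum>i\<in>{1..<j}. s i) + (1 - kraw_arg \<rho> j) * s j) *
            (1 + (\<Sum>i\<in>{1..<j}. t i) + (1 - kraw_arg \<rho> j) * t j)) +
      (1 - (\<Sum>i=1..p. \<rho> i)) * (1 + (\<Sum>i=1..p. s i)) * (1 + (\<Sum>i=1..p. t i)) =
      (\<Sum>j=1..p. kraw_scale \<rho> j * s j * t j) + 1"
  using assms
proof (induction p)
  case (Suc p)
  define q where "q = 1 - (\<Sum>i=1..p. \<rho> i)"
  define r where "r = \<rho> (Suc p)"
  have r: "r \<noteq> 0" using Suc.prems by (simp add: r_def)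
  have ivl: "{1..<Suc p} = {1..p}" by auto
  have arg: "1 - kraw_arg \<rho> (Suc p) = (r - q) / r"
    using r unfolding kraw_arg_def ivl by (simp add: q_def r_def field_simps)
  have sc: "kraw_scale \<rho> (Suc p) = (q - r) * q / r"
    unfolding kraw_scale_def ivl by (simp add: q_def r_def)
  have q': "1 - (\<Sum>i=1..Suc p. \<rho> i) = q - r" by (simp add: q_def r_def)
  \<comment> \<open>the mixed terms \<open>L b + L' a\<close> have coefficient \<open>(r - q) + (q - r) = 0\<close>\<close>
  have step: "r * (L + (r - q) / r * a) * (L' + (r - q) / r * b) + (q - r) * (L + a) * (L' + b) =
     q * L * L' + (q - r) * q / r * a * b" for L L' a b :: real
    using r by (simp add: field_simps)
  define L L' where "L = 1 + (\<Sum>i=1..p. s i)" and "L' = 1 + (\<Sum>i=1..p. t i)"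
  define A B where "A = (\<Sum>j=1..p. \<rho> j * (1 + (\<Sum>i\<in>{1..<j}. s i) + (1 - kraw_arg \<rho> j) * s j) *
            (1 + (\<Sum>i\<in>{1..<j}. t i) + (1 - kraw_arg \<rho> j) * t j))"
    and "B = (\<Sum>j=1..p. kraw_scale \<rho> j * s j * t j)"
  have IH: "A + q * L * L' = B + 1"
    unfolding A_def B_def L_def L'_def q_def by (rule Suc.IH) (use Suc.prems in auto)
  have sums: "1 + (\<Sum>i=1..Suc p. s i) = L + s (Suc p)" "1 + (\<Sum>i=1..Suc p. t i) = L' + t (Suc p)"
    by (simp_all add: L_def L'_def)
  have "(\<Sum>j=1..Suc p. \<rho> j * (1 + (\<Sum>i\<in>{1..<j}. s i) + (1 - kraw_arg \<rho> j) * s j) *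
            (1 + (\<Sum>i\<in>{1..<j}. t i) + (1 - kraw_arg \<rho> j) * t j)) =
      A + r * (L + (r - q) / r * s (Suc p)) * (L' + (r - q) / r * t (Suc p))"
    unfolding sum.nat_ivl_Suc'[of 1 p, OF le_add2[of 1 p, unfolded Suc_eq_plus1[symmetric]]] ivl arg
    by (simp only: r_def[symmetric] A_def[symmetric] L_def[symmetric] L'_def[symmetric] add.commute)
  moreover have "(\<Sum>j=1..Suc p. kraw_scale \<rho> j * s j * t j) = B + (q - r) * q / r * s (Suc p) * t (Suc p)"
    by (simp add: B_def sc)
  ultimately show ?case
    unfolding q' sums using IH step[of L "s (Suc p)" L' "t (Suc p)"] by linarith
qed simp

text \<open>
Both sides are the coefficients of \<open>s\<^sup>\<mu> t\<^sup>\<nu>\<close> in \<open>(1 + \<Sum>\<^sub>j c\<^sub>j s\<^sub>j t\<^sub>j)\<^sup>N\<close>: on the left through the generating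
functions, the multinomial theorem and \<open>kraw_bilinear_form\<close>, on the right by expanding that power directly.
\<close>
theorem kcoef_orthogonality:
  assumes \<rho>: "\<And>i. i \<in> {1..p} \<Longrightarrow> \<rho> i \<noteq> 0"
    and \<mu>: "\<mu> \<in> grid p N" and \<nu>: "\<nu> \<in> grid p N"
  shows "(\<Sum>x\<in>grid p N. kcoef p (kraw_arg \<rho>) (real N) \<mu> (\<lambda>i. real (x i)) *
            kcoef p (kraw_arg \<rho>) (real N) \<nu> (\<lambda>i. real (x i)) * kraw_weight p \<rho> N x) =
         (if \<mu> = \<nu> then multinom p N \<nu> * (\<Prod>j=1..p. kraw_scale \<rho> j ^ \<nu> j) else 0)"
    (is "?I \<mu> \<nu> = ?D \<mu> \<nu>")
proof -
  let ?K = "\<lambda>\<nu> x. kcoef p (kraw_arg \<rho>) (real N) \<nu> (\<lambda>i. real (x i))"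
  let ?m = "\<lambda>s \<nu>. (\<Prod>i=1..p. s i ^ \<nu> i) :: real"
  define q where "q = 1 - (\<Sum>i=1..p. \<rho> i)"
  have eq: "(\<Sum>\<mu>\<in>grid p N. (\<Sum>\<nu>\<in>grid p N. ?I \<mu> \<nu> * ?m t \<nu>) * ?m s \<mu>) =
        (\<Sum>\<mu>\<in>grid p N. (\<Sum>\<nu>\<in>grid p N. ?D \<mu> \<nu> * ?m t \<nu>) * ?m s \<mu>)" for s t
  proof -
    define l where "l s j = 1 + (\<Sum>i\<in>{1..<j}. s i) + (1 - kraw_arg \<rho> j) * s j" for s j
    define l0 where "l0 s = 1 + (\<Sum>i=1..p. s i)" for s :: "nat \<Rightarrow> real"
    have G: "(\<Sum>\<nu>\<in>grid p N. ?K \<nu> x * ?m s \<nu>) = (\<Prod>j=1..p. l s j ^ x j) * l0 s ^ (N - (\<Sum>i=1..p. x i))"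
      if "x \<in> grid p N" for x s
      unfolding l_def l0_def
      by (rule kcoef_generating_function_grid) (use that in \<open>simp add: grid_def\<close>)
    have "(\<Sum>\<mu>\<in>grid p N. (\<Sum>\<nu>\<in>grid p N. ?I \<mu> \<nu> * ?m t \<nu>) * ?m s \<mu>) =
      (\<Sum>x\<in>grid p N. kraw_weight p \<rho> N x * ((\<Sum>\<mu>\<in>grid p N. ?K \<mu> x * ?m s \<mu>) * (\<Sum>\<nu>\<in>grid p N. ?K \<nu> x * ?m t \<nu>)))"
    proof -
      have "(\<Sum>\<mu>\<in>grid p N. (\<Sum>\<nu>\<in>grid p N. ?I \<mu> \<nu> * ?m t \<nu>) * ?m s \<mu>) =
         (\<Sum>\<mu>\<in>grid p N. \<Sum>\<nu>\<in>grid p N. \<Sum>x\<in>grid p N. kraw_weight p \<rho> N x * ((?K \<mu> x * ?m s \<mu>) * (?K \<nu> x * ?m t \<nu>)))"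
        unfolding sum_distrib_right by (simp only: mult_ac)
      also have "\<dots> = (\<Sum>x\<in>grid p N. \<Sum>\<mu>\<in>grid p N. \<Sum>\<nu>\<in>grid p N. kraw_weight p \<rho> N x * ((?K \<mu> x * ?m s \<mu>) * (?K \<nu> x * ?m t \<nu>)))"
        by (subst sum.swap[where B = "grid p N"], subst (2) sum.swap) (rule refl)
      also have "\<dots> = (\<Sum>x\<in>grid p N. kraw_weight p \<rho> N x * ((\<Sum>\<mu>\<in>grid p N. ?K \<mu> x * ?m s \<mu>) * (\<Sum>\<nu>\<in>grid p N. ?K \<nu> x * ?m t \<nu>)))"
        by (simp only: sum_product) (simp only: sum_distrib_left)
      finally show ?thesis .
    qed
    also have "\<dots> = (\<Sum>x\<in>grid p N. multinom p N x * (\<Prod>j=1..p. (\<rho> j * l s j * l t j) ^ x j) *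
        (q * l0 s * l0 t) ^ (N - (\<Sum>i=1..p. x i)))"
    proof (intro sum.cong refl)
      fix x assume x: "x \<in> grid p N"
      show "kraw_weight p \<rho> N x * ((\<Sum>\<mu>\<in>grid p N. ?K \<mu> x * ?m s \<mu>) * (\<Sum>\<nu>\<in>grid p N. ?K \<nu> x * ?m t \<nu>)) =
         multinom p N x * (\<Prod>j=1..p. (\<rho> j * l s j * l t j) ^ x j) * (q * l0 s * l0 t) ^ (N - (\<Sum>i=1..p. x i))"
        unfolding G[OF x] kraw_weight_eq q_def[symmetric] power_mult_distrib prod.distrib
        by (simp only: mult_ac)
    qed
    also have "\<dots> = ((\<Sum>j=1..p. \<rho> j * l s j * l t j) + q * l0 s * l0 t) ^ N"
      by (rule multinomial_theorem_grid)
    also have "(\<Sum>j=1..p. \<rho> j * l s j * l t j) + q * l0 s * l0 t = (\<Sum>j=1..p. kraw_scale \<rho> j * t j * s j) + 1"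
      unfolding q_def l_def l0_def using kraw_bilinear_form[of p \<rho> t s, OF \<rho>] by (simp only: mult_ac)
    also have "\<dots> ^ N = (\<Sum>\<nu>\<in>grid p N. multinom p N \<nu> * (\<Prod>j=1..p. (kraw_scale \<rho> j * t j * s j) ^ \<nu> j) *
        1 ^ (N - (\<Sum>i=1..p. \<nu> i)))"
      by (rule multinomial_theorem_grid[symmetric])
    also have "\<dots> = (\<Sum>\<mu>\<in>grid p N. (\<Sum>\<nu>\<in>grid p N. ?D \<mu> \<nu> * ?m t \<nu>) * ?m s \<mu>)"
    proof (intro sum.cong refl)
      fix \<mu> assume "\<mu> \<in> grid p N"
      then have "(\<Sum>\<nu>\<in>grid p N. ?D \<mu> \<nu> * ?m t \<nu>) = multinom p N \<mu> * (\<Prod>j=1..p. kraw_scale \<rho> j ^ \<mu> j) * ?m t \<mu>"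
        by (simp add: if_distrib[of "\<lambda>x. x * _"] sum.delta cong: if_cong)
      then show "multinom p N \<mu> * (\<Prod>j=1..p. (kraw_scale \<rho> j * t j * s j) ^ \<mu> j) * 1 ^ (N - (\<Sum>i=1..p. \<mu> i)) =
          (\<Sum>\<nu>\<in>grid p N. ?D \<mu> \<nu> * ?m t \<nu>) * ?m s \<mu>"
        by (simp add: power_mult_distrib prod.distrib mult_ac)
    qed
    finally show ?thesis .
  qed
  \<comment> \<open>coefficients are compared first in \<open>s\<close>, for each fixed \<open>t\<close>, and then in \<open>t\<close>\<close>
  have "(\<Sum>\<nu>\<in>grid p N. ?I \<mu> \<nu> * ?m t \<nu>) = (\<Sum>\<nu>\<in>grid p N. ?D \<mu> \<nu> * ?m t \<nu>)" for t
    using eq \<mu> by (rule monomials_coeff_eq)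
  then show ?thesis using \<nu>
    by (rule monomials_coeff_eq[where a = "?I \<mu>" and b = "?D \<mu>"])
qed

lemma kraw_cong:
  assumes "\<And>i. i \<in> {1..p} \<Longrightarrow> \<mu> i = \<nu> i"
  shows "kraw p \<rho> N \<mu> x = kraw p \<rho> N \<nu> x"
proof -
  have "(\<Sum>i\<in>{j<..p}. \<mu> i) = (\<Sum>i\<in>{j<..p}. \<nu> i)" if "j \<ge> 1" for j
    using that by (intro sum.cong) (auto intro: assms)
  moreover have "(\<Sum>i=1..p. \<mu> i) = (\<Sum>i=1..p. \<nu> i)" by (intro sum.cong) (auto intro: assms)
  ultimately show ?thesis
    unfolding kraw_def by (auto intro!: prod.cong arg_cong2[where f = "(*)"] simp: assms)
qed

context
  fixes p N :: nat and \<rho> :: "nat \<Rightarrow> real"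
  assumes \<rho>: "\<And>i. i \<in> {1..p} \<Longrightarrow> \<rho> i > 0" "(\<Sum>i=1..p. \<rho> i) < 1"
begin

lemma partial_sum_less_1:
  assumes "A \<subseteq> {1..p}"
  shows "(\<Sum>i\<in>A. \<rho> i) < 1"
proof -
  have "(\<Sum>i\<in>A. \<rho> i) \<le> (\<Sum>i=1..p. \<rho> i)"
    using assms \<rho>(1) by (intro sum_mono2) (auto simp: less_imp_le)
  then show ?thesis using \<rho>(2) by simp
qed

lemma kraw_scale_pos: "j \<in> {1..p} \<Longrightarrow> kraw_scale \<rho> j > 0"
  unfolding kraw_scale_def
  using partial_sum_less_1[of "{1..j}"] partial_sum_less_1[of "{1..<j}"] \<rho>(1)[of j]
  by (intro divide_pos_pos mult_pos_pos) (auto simp: subset_iff)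

lemma kraw_scale_prod_pos: "(\<Prod>j=1..p. kraw_scale \<rho> j ^ \<nu> j) > 0"
  by (intro prod_pos ballI zero_less_power kraw_scale_pos)

lemma kraw_inner_eq:
  assumes "\<mu> \<in> grid p N" "\<nu> \<in> grid p N"
  shows "kraw_inner p \<rho> N (kraw p \<rho> N \<mu>) (kraw p \<rho> N \<nu>) =
    (if \<mu> = \<nu> then (\<Prod>j=1..p. kraw_scale \<rho> j ^ \<nu> j) / multinom p N \<nu> else 0)"
proof -
  have *: "(\<Sum>i=1..p. \<mu> i) \<le> N" "(\<Sum>i=1..p. \<nu> i) \<le> N" using assms by (auto simp: grid_def)
  have "kraw_inner p \<rho> N (kraw p \<rho> N \<mu>) (kraw p \<rho> N \<nu>) =
    (\<Sum>x\<in>grid p N. kcoef p (kraw_arg \<rho>) (real N) \<mu> (\<lambda>i. real (x i)) *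
            kcoef p (kraw_arg \<rho>) (real N) \<nu> (\<lambda>i. real (x i)) * kraw_weight p \<rho> N x) /
      (multinom p N \<mu> * multinom p N \<nu>)"
    unfolding kraw_inner_def kraw_eq_kcoef[OF *(1)] kraw_eq_kcoef[OF *(2)] sum_divide_distrib
    by (simp add: field_simps)
  also have "\<dots> = (if \<mu> = \<nu> then (\<Prod>j=1..p. kraw_scale \<rho> j ^ \<nu> j) / multinom p N \<nu> else 0)"
    using multinom_pos[of p N \<nu>] \<rho>(1) assms
    by (subst kcoef_orthogonality) (auto simp: less_imp_neq[symmetric] field_simps)
  finally show ?thesis .
qed

text \<open>
Shifted and reversed multi-indices need not vanish off \<open>{1..p}\<close>, so they are truncated before the
orthogonality relation is applied.
\<close>
lemma kraw_norm2_eq: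
  assumes "(\<Sum>i=1..p. \<nu> i) \<le> N"
  shows "kraw_norm2 p \<rho> N \<nu> = (\<Prod>j=1..p. kraw_scale \<rho> j ^ \<nu> j) / multinom p N \<nu>"
proof -
  define \<nu>' where "\<nu>' = (\<lambda>i. if i \<in> {1..p} then \<nu> i else 0)"
  have \<nu>': "\<nu>' i = \<nu> i" if "i \<in> {1..p}" for i using that by (simp add: \<nu>'_def)
  have s: "(\<Sum>i=1..p. \<nu>' i) = (\<Sum>i=1..p. \<nu> i)" by (intro sum.cong) (auto simp: \<nu>')
  have g: "\<nu>' \<in> grid p N" using assms s by (auto simp: grid_def \<nu>'_def)
  have "kraw p \<rho> N \<nu> = kraw p \<rho> N \<nu>'" by (intro ext kraw_cong) (simp add: \<nu>')
  moreover have "(\<Prod>j=1..p. kraw_scale \<rho> j ^ \<nu>' j) = (\<Prod>j=1..p. kraw_scale \<rho> j ^ \<nu> j)"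
    by (intro prod.cong) (auto simp: \<nu>')
  moreover have "multinom p N \<nu>' = multinom p N \<nu>"
    unfolding multinom_def s by (intro arg_cong2[where f = "(/)"] arg_cong2[where f = "(*)"] prod.cong) (auto simp: \<nu>')
  ultimately show ?thesis
    using kraw_inner_eq[OF g g] by (simp add: kraw_norm2_def)
qed

theorem kraw_hat_eq_kcoef:
  assumes "(\<Sum>i=1..p. \<nu> i) \<le> N"
  shows "kraw_hat p \<rho> N \<nu> x =
    kcoef p (kraw_arg \<rho>) (real N) \<nu> x / sqrt (multinom p N \<nu> * (\<Prod>j=1..p. kraw_scale \<rho> j ^ \<nu> j))"
proof -
  have m: "multinom p N \<nu> = sqrt (multinom p N \<nu>) * sqrt (multinom p N \<nu>)"
    "sqrt (multinom p N \<nu>) > 0"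
    using multinom_pos[of p N \<nu>] by simp_all
  show ?thesis
    unfolding kraw_hat_def kraw_norm2_eq[OF assms] kraw_eq_kcoef[OF assms] real_sqrt_divide real_sqrt_mult
    using m(2) by (subst m(1)) (simp add: field_simps del: real_sqrt_mult_self)
qed

text \<open>
Pairing a vanishing combination with one of the polynomials isolates its coefficient, since distinct
polynomials are orthogonal and all norms are positive.
\<close>
lemma kraw_hat_linear_independent:
  assumes "finite M" "M \<subseteq> grid p N" "\<And>\<alpha>. (\<Sum>\<mu>\<in>M. b \<mu> * kraw_hat p \<rho> N \<mu> \<alpha>) = 0" "\<nu> \<in> M"
  shows "b \<nu> = 0"
proof -
  have n: "kraw_norm2 p \<rho> N \<mu> > 0" if "\<mu> \<in> M" for \<mu>
    using kraw_norm2_eq[of \<mu>] that assms(2) kraw_scale_prod_pos[of \<mu>] multinom_pos[of p N \<mu>]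
    by (auto simp: grid_def)
  have "0 = kraw_inner p \<rho> N (\<lambda>\<alpha>. \<Sum>\<mu>\<in>M. b \<mu> * kraw_hat p \<rho> N \<mu> \<alpha>) (kraw p \<rho> N \<nu>)"
    by (simp add: assms(3) kraw_inner_def)
  also have "\<dots> = (\<Sum>\<mu>\<in>M. b \<mu> / sqrt (kraw_norm2 p \<rho> N \<mu>) * kraw_inner p \<rho> N (kraw p \<rho> N \<mu>) (kraw p \<rho> N \<nu>))"
    unfolding kraw_inner_def kraw_hat_def sum_distrib_right sum_distrib_left
    by (subst sum.swap) (simp add: mult_ac)
  also have "\<dots> = (\<Sum>\<mu>\<in>M. if \<mu> = \<nu> then b \<mu> / sqrt (kraw_norm2 p \<rho> N \<mu>) * kraw_norm2 p \<rho> N \<nu> else 0)"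
    using assms(2,4) by (intro sum.cong refl) (auto simp: kraw_norm2_def kraw_inner_eq subset_iff)
  also have "\<dots> = b \<nu> / sqrt (kraw_norm2 p \<rho> N \<nu>) * kraw_norm2 p \<rho> N \<nu>"
    using assms(1,4) by simp
  finally show ?thesis using n[OF assms(4)] by auto
qed

end

section \<open>Duality\<close>

lemma multinom_cong:
  assumes "\<And>i. i \<in> {1..p} \<Longrightarrow> x i = y i"
  shows "multinom p N x = multinom p N y"
proof -
  have "(\<Sum>i=1..p. x i) = (\<Sum>i=1..p. y i)" by (intro sum.cong refl assms)
  moreover have "(\<Prod>i=1..p. fact (x i)) = (\<Prod>i=1..p. fact (y i) :: real)" 
    by (intro prod.cong) (auto simp: assms)
  ultimately show ?thesis by (simp add: multinom_def)
qed

lemma kcoef_cong: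
  assumes "\<And>i. i \<in> {1..p} \<Longrightarrow> z i = z' i" "\<And>i. i \<in> {1..p} \<Longrightarrow> \<mu> i = \<nu> i" "\<And>i. i \<in> {1..p} \<Longrightarrow> x i = y i"
  shows "kcoef p z N \<mu> x = kcoef p z' N \<nu> y"
proof -
  have "(\<Sum>i\<in>{j<..p}. \<mu> i) = (\<Sum>i\<in>{j<..p}. \<nu> i)" "(\<Sum>i\<in>{1..<j}. x i) = (\<Sum>i\<in>{1..<j}. y i)" if "j \<in> {1..p}" for j
    using that by (auto intro!: sum.cong assms)
  then show ?thesis
    unfolding kcoef_def using assms by (intro prod.cong refl) (simp only:)
qed

definition rev_index :: "nat \<Rightarrow> (nat \<Rightarrow> nat) \<Rightarrow> nat \<Rightarrow> nat" where
  "rev_index p x = (\<lambda>j. if j \<in> {1..p} then x (p + 1 - j) else 0)"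

lemma sum_rev: fixes p :: nat shows "(\<Sum>i=1..p. f (p + 1 - i)) = (\<Sum>i=1..p. f i)"
  by (rule sum.reindex_bij_witness[of _ "\<lambda>i. p + 1 - i" "\<lambda>i. p + 1 - i"]) auto

lemma prod_rev: fixes p :: nat shows "(\<Prod>i=1..p. f (p + 1 - i)) = (\<Prod>i=1..p. f i)"
  by (rule prod.reindex_bij_witness[of _ "\<lambda>i. p + 1 - i" "\<lambda>i. p + 1 - i"]) auto

lemma rev_index_in_grid:
  assumes "x \<in> grid p N"
  shows "rev_index p x \<in> grid p N"
proof -
  have "(\<Sum>i=1..p. rev_index p x i) = (\<Sum>i=1..p. x (p + 1 - i))"
    by (intro sum.cong) (auto simp: rev_index_def)
  also have "\<dots> = (\<Sum>i=1..p. x i)" by (rule sum_rev)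
  finally show ?thesis using assms by (auto simp: grid_def) (auto simp: rev_index_def)
qed

lemma rev_index_rev_index:
  assumes "x \<in> grid p N"
  shows "rev_index p (rev_index p x) = x"
  using assms by (auto simp: rev_index_def grid_def fun_eq_iff)

lemma sum_grid_rev: "(\<Sum>x\<in>grid p N. f (rev_index p x)) = (\<Sum>x\<in>grid p N. f x)"
  by (rule sum.reindex_bij_witness[of _ "rev_index p" "rev_index p"])
     (auto simp: rev_index_rev_index rev_index_in_grid)

lemma sum_prod_triangle_swap:
  fixes f :: "nat \<Rightarrow> nat \<Rightarrow> real"
  shows "(\<Sum>j=1..p. \<Sum>i\<in>{1..<j}. f i j) = (\<Sum>i=1..p. \<Sum>j\<in>{i<..p}. f i j)"
  unfolding sum.Sigma[OF finite_atLeastAtMost ballI[OF finite_atLeastLessThan]]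
     sum.Sigma[OF finite_atLeastAtMost ballI[OF finite_greaterThanAtMost]]
  by (rule sum.reindex_bij_witness[of _ "\<lambda>(a, b). (b, a)" "\<lambda>(a, b). (b, a)"]) auto

text \<open>
The bilinear form behind duality: it contains \<open>y\<^sub>j s\<^sub>i\<close> exactly for \<open>i < j\<close>, with \<open>s\<^sub>0 = y\<^bsub>p+1\<^esub> = 1\<close>, and
\<open>a\<^sub>j y\<^sub>j s\<^sub>j\<close>.  Collected by \<open>s\<close> instead of \<open>y\<close>, the inner sums run over the indices above \<open>j\<close>, so the shape
is restored by reversing the numbering.
\<close>
lemma kraw_form_symmetric:
  fixes y s a :: "nat \<Rightarrow> real"
  shows "(\<Sum>j=1..p. y j * (1 + (\<Sum>i\<in>{1..<j}. s i) + a j * s j)) + (1 + (\<Sum>i=1..p. s i)) =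
    (\<Sum>j=1..p. s j * (1 + (\<Sum>i\<in>{j<..p}. y i) + a j * y j)) + (1 + (\<Sum>i=1..p. y i))"
  using sum_prod_triangle_swap[of "\<lambda>i j. y j * s i" p]
  by (simp add: distrib_left sum.distrib sum_distrib_left mult_ac)

text \<open>
The generating function with all vectors read backwards; the partial sums become sums over the indices
above \<open>j\<close>.
\<close>
lemma kcoef_generating_function_rev:
  assumes "(\<Sum>i=1..p. \<nu> i) \<le> N"
  shows "(\<Sum>x\<in>grid p N. kcoef p (\<lambda>j. z (p + 1 - j)) (real N) (rev_index p x) (\<lambda>i. real (\<nu> (p + 1 - i))) * (\<Prod>i=1..p. y i ^ x i)) =
    (\<Prod>j=1..p. (1 + (\<Sum>i\<in>{j<..p}. y i) + (1 - z j) * y j) ^ \<nu> j) * (1 + (\<Sum>i=1..p. y i)) ^ (N - (\<Sum>i=1..p. \<nu> i))"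
proof -
  let ?K = "\<lambda>x. kcoef p (\<lambda>j. z (p + 1 - j)) (real N) x (\<lambda>i. real (\<nu> (p + 1 - i)))"
  have "(\<Sum>x\<in>grid p N. ?K (rev_index p x) * (\<Prod>i=1..p. y i ^ x i)) =
     (\<Sum>x\<in>grid p N. ?K (rev_index p x) * (\<Prod>i=1..p. y (p + 1 - i) ^ rev_index p x i))"
  proof (intro sum.cong refl arg_cong2[where f = "(*)"])
    fix x
    have "(\<Prod>i=1..p. y (p + 1 - i) ^ rev_index p x i) = (\<Prod>i=1..p. y (p + 1 - i) ^ x (p + 1 - i))"
      by (intro prod.cong) (auto simp: rev_index_def)
    then show "(\<Prod>i=1..p. y i ^ x i) = (\<Prod>i=1..p. y (p + 1 - i) ^ rev_index p x i)"
      by (simp only: prod_rev[of "\<lambda>i. y i ^ x i"])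
  qed
  also have "\<dots> = (\<Sum>x\<in>grid p N. ?K x * (\<Prod>i=1..p. y (p + 1 - i) ^ x i))"
    by (rule sum_grid_rev)
  also have "\<dots> = (\<Prod>j=1..p. (1 + (\<Sum>i\<in>{1..<j}. y (p + 1 - i)) + (1 - z (p + 1 - j)) * y (p + 1 - j)) ^ \<nu> (p + 1 - j)) *
      (1 + (\<Sum>i=1..p. y (p + 1 - i))) ^ (N - (\<Sum>i=1..p. \<nu> (p + 1 - i)))"
    by (rule kcoef_generating_function_grid) (use assms in \<open>simp only: sum_rev\<close>)
  also have "(\<Prod>j=1..p. (1 + (\<Sum>i\<in>{1..<j}. y (p + 1 - i)) + (1 - z (p + 1 - j)) * y (p + 1 - j)) ^ \<nu> (p + 1 - j)) =
     (\<Prod>j=1..p. (1 + (\<Sum>i\<in>{p + 1 - j<..p}. y i) + (1 - z (p + 1 - j)) * y (p + 1 - j)) ^ \<nu> (p + 1 - j))"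
  proof (intro prod.cong refl)
    fix j assume "j \<in> {1..p}"
    then have "(\<Sum>i\<in>{1..<j}. y (p + 1 - i)) = (\<Sum>i\<in>{p + 1 - j<..p}. y i)"
      by (intro sum.reindex_bij_witness[of _ "\<lambda>i. p + 1 - i" "\<lambda>i. p + 1 - i"]) auto
    then show "(1 + (\<Sum>i\<in>{1..<j}. y (p + 1 - i)) + (1 - z (p + 1 - j)) * y (p + 1 - j)) ^ \<nu> (p + 1 - j) =
      (1 + (\<Sum>i\<in>{p + 1 - j<..p}. y i) + (1 - z (p + 1 - j)) * y (p + 1 - j)) ^ \<nu> (p + 1 - j)" by simp
  qed
  also have "\<dots> = (\<Prod>j=1..p. (1 + (\<Sum>i\<in>{j<..p}. y i) + (1 - z j) * y j) ^ \<nu> j)"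
    by (rule prod_rev)
  finally show ?thesis by (simp only: sum_rev)
qed

text \<open>
Both sides are the coefficients of \<open>y\<^sup>x s\<^sup>\<nu>\<close> in the \<open>N\<close>-th power of the form in \<open>kraw_form_symmetric\<close>,
collected once by \<open>y\<close> and once by \<open>s\<close>.
\<close>
lemma kcoef_duality_grid:
  assumes x: "x \<in> grid p N" and \<nu>: "\<nu> \<in> grid p N"
  shows "multinom p N x * kcoef p z (real N) \<nu> (\<lambda>i. real (x i)) =
    multinom p N \<nu> * kcoef p (\<lambda>j. z (p + 1 - j)) (real N) (rev_index p x) (\<lambda>i. real (\<nu> (p + 1 - i)))"
    (is "?A x \<nu> = ?B x \<nu>")
proof -
  let ?m = "\<lambda>s \<nu>. (\<Prod>i=1..p. s i ^ \<nu> i) :: real"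
  have eq: "(\<Sum>x\<in>grid p N. (\<Sum>\<nu>\<in>grid p N. ?A x \<nu> * ?m s \<nu>) * ?m y x) =
        (\<Sum>x\<in>grid p N. (\<Sum>\<nu>\<in>grid p N. ?B x \<nu> * ?m s \<nu>) * ?m y x)" for s y
  proof -
    have "(\<Sum>x\<in>grid p N. (\<Sum>\<nu>\<in>grid p N. ?A x \<nu> * ?m s \<nu>) * ?m y x) =
      (\<Sum>x\<in>grid p N. multinom p N x * (\<Prod>j=1..p. (y j * (1 + (\<Sum>i\<in>{1..<j}. s i) + (1 - z j) * s j)) ^ x j) *
         (1 + (\<Sum>i=1..p. s i)) ^ (N - (\<Sum>i=1..p. x i)))"
    proof (intro sum.cong refl)
      fix x assume "x \<in> grid p N"
      then have le: "(\<Sum>i=1..p. x i) \<le> N" by (simp add: grid_def)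
      show "(\<Sum>\<nu>\<in>grid p N. ?A x \<nu> * ?m s \<nu>) * ?m y x = multinom p N x *
         (\<Prod>j=1..p. (y j * (1 + (\<Sum>i\<in>{1..<j}. s i) + (1 - z j) * s j)) ^ x j) *
         (1 + (\<Sum>i=1..p. s i)) ^ (N - (\<Sum>i=1..p. x i))"
        unfolding mult.assoc sum_distrib_left[symmetric] kcoef_generating_function_grid[OF le]
        by (simp only: power_mult_distrib prod.distrib mult_ac)
    qed
    also have "\<dots> = (\<Sum>\<nu>\<in>grid p N. multinom p N \<nu> *
        (\<Prod>j=1..p. (s j * (1 + (\<Sum>i\<in>{j<..p}. y i) + (1 - z j) * y j)) ^ \<nu> j) *
        (1 + (\<Sum>i=1..p. y i)) ^ (N - (\<Sum>i=1..p. \<nu> i)))"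
      unfolding multinomial_theorem_grid by (simp only: kraw_form_symmetric)
    also have "\<dots> = (\<Sum>\<nu>\<in>grid p N. (\<Sum>x\<in>grid p N. ?B x \<nu> * ?m y x) * ?m s \<nu>)"
    proof (intro sum.cong refl)
      fix \<nu> assume "\<nu> \<in> grid p N"
      then have le: "(\<Sum>i=1..p. \<nu> i) \<le> N" by (simp add: grid_def)
      show "multinom p N \<nu> *
        (\<Prod>j=1..p. (s j * (1 + (\<Sum>i\<in>{j<..p}. y i) + (1 - z j) * y j)) ^ \<nu> j) *
        (1 + (\<Sum>i=1..p. y i)) ^ (N - (\<Sum>i=1..p. \<nu> i)) = (\<Sum>x\<in>grid p N. ?B x \<nu> * ?m y x) * ?m s \<nu>"
        unfolding mult.assoc sum_distrib_left[symmetric] kcoef_generating_function_rev[OF le]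
        by (simp only: power_mult_distrib prod.distrib mult_ac)
    qed
    also have "\<dots> = (\<Sum>x\<in>grid p N. (\<Sum>\<nu>\<in>grid p N. ?B x \<nu> * ?m s \<nu>) * ?m y x)"
      unfolding sum_distrib_right by (subst sum.swap) (simp only: mult_ac)
    finally show ?thesis .
  qed
  have "(\<Sum>\<nu>\<in>grid p N. ?A x \<nu> * ?m s \<nu>) = (\<Sum>\<nu>\<in>grid p N. ?B x \<nu> * ?m s \<nu>)" for s
    using eq x by (rule monomials_coeff_eq)
  then show ?thesis using \<nu>
    by (rule monomials_coeff_eq[where a = "?A x" and b = "?B x"])
qed

text \<open>
Duality in a form that applies to shifted vectors as they stand: the reversed vectors are only
prescribed on \<open>{1..p}\<close>.
\<close>
lemma kcoef_duality:
  assumes x: "(\<Sum>i=1..p. x i) \<le> N" and \<nu>: "(\<Sum>i=1..p. \<nu> i) \<le> N"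
    and x': "\<And>j. j \<in> {1..p} \<Longrightarrow> x' j = x (p + 1 - j)"
    and \<nu>': "\<And>j. j \<in> {1..p} \<Longrightarrow> \<nu>' j = \<nu> (p + 1 - j)"
    and z': "\<And>j. j \<in> {1..p} \<Longrightarrow> z' j = z (p + 1 - j)"
  shows "multinom p N x * kcoef p z (real N) \<nu> (\<lambda>i. real (x i)) =
    multinom p N \<nu> * kcoef p z' (real N) x' (\<lambda>i. real (\<nu>' i))"
proof -
  define t where "t f = (\<lambda>i. if i \<in> {1..p} then f i else (0::nat))" for f
  have t: "t f i = f i" if "i \<in> {1..p}" for f i using that by (simp add: t_def)
  have s: "(\<Sum>i=1..p. t f i) = (\<Sum>i=1..p. f i)" for f by (intro sum.cong) (auto simp: t)
  have g: "t x \<in> grid p N" "t \<nu> \<in> grid p N" using x \<nu> s by (auto simp: grid_def t_def)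
  have "multinom p N x * kcoef p z (real N) \<nu> (\<lambda>i. real (x i)) =
     multinom p N (t x) * kcoef p z (real N) (t \<nu>) (\<lambda>i. real (t x i))"
    by (intro arg_cong2[where f = "(*)"] multinom_cong kcoef_cong) (auto simp: t)
  also have "\<dots> = multinom p N (t \<nu>) *
     kcoef p (\<lambda>j. z (p + 1 - j)) (real N) (rev_index p (t x)) (\<lambda>i. real (t \<nu> (p + 1 - i)))"
    by (rule kcoef_duality_grid[OF g])
  also have "\<dots> = multinom p N \<nu> * kcoef p z' (real N) x' (\<lambda>i. real (\<nu>' i))"
    by (intro arg_cong2[where f = "(*)"] multinom_cong kcoef_cong)
       (auto simp: t_def x' \<nu>' z' rev_index_def)
  finally show ?thesis .
qed


definition tail_mass :: "(nat \<Rightarrow> real) \<Rightarrow> nat \<Rightarrow> real" where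
  "tail_mass \<rho> j = 1 - (\<Sum>i=1..j. \<rho> i)"

lemma tail_mass_0 [simp]: "tail_mass \<rho> 0 = 1"
  by (simp add: tail_mass_def)

lemma tail_mass_Suc: "tail_mass \<rho> (Suc j) = tail_mass \<rho> j - \<rho> (Suc j)"
  by (simp add: tail_mass_def)

lemma tail_mass_pred: "j \<ge> 1 \<Longrightarrow> 1 - (\<Sum>i\<in>{1..<j}. \<rho> i) = tail_mass \<rho> (j - 1)"
  by (cases j) (auto simp: tail_mass_def atLeastLessThanSuc_atLeastAtMost)

lemma kraw_arg_tail_mass: "j \<ge> 1 \<Longrightarrow> kraw_arg \<rho> j = tail_mass \<rho> (j - 1) / \<rho> j"
  by (simp only: kraw_arg_def tail_mass_pred)

lemma kraw_scale_tail_mass: "j \<ge> 1 \<Longrightarrow> kraw_scale \<rho> j = tail_mass \<rho> j * tail_mass \<rho> (j - 1) / \<rho> j"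
  by (simp only: kraw_scale_def tail_mass_pred) (simp add: tail_mass_def)

lemma tail_mass_pos:
  assumes "\<And>i. i \<in> {1..p} \<Longrightarrow> \<rho> i > 0" "(\<Sum>i=1..p. \<rho> i) < 1" "j \<le> p"
  shows "tail_mass \<rho> j > 0"
  using partial_sum_less_1[of p \<rho> "{1..j}"] assms by (auto simp: tail_mass_def)

text \<open>
The parameter \<open>\<sigma>\<close> with \<open>z\<^sub>j(\<sigma>) = z\<^bsub>p+1-j\<^esub>(\<rho>)\<close>, which is what duality of the unnormalized polynomials requires.
\<close>
definition dual_rho :: "nat \<Rightarrow> (nat \<Rightarrow> real) \<Rightarrow> nat \<Rightarrow> real" where
  "dual_rho p \<rho> j =
     tail_mass \<rho> p * \<rho> (p + 1 - j) / (tail_mass \<rho> (p + 1 - j) * tail_mass \<rho> (p - j))"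

context
  fixes p :: nat and \<rho> \<sigma> :: "nat \<Rightarrow> real"
  assumes \<rho>: "\<And>i. i \<in> {1..p} \<Longrightarrow> \<rho> i > 0" "(\<Sum>i=1..p. \<rho> i) < 1"
    and \<sigma>: "\<And>j. j \<in> {1..p} \<Longrightarrow> \<sigma> j = dual_rho p \<rho> j"
begin

private lemma mass_pos: "j \<le> p \<Longrightarrow> tail_mass \<rho> j > 0"
  using tail_mass_pos[OF \<rho>] by simp

private lemma \<rho>_rev_pos: "j \<in> {1..p} \<Longrightarrow> \<rho> (p + 1 - j) > 0"
  by (rule \<rho>(1)) auto

text \<open>
The sum telescopes, since \<open>\<rho>\<^sub>j / (q\<^sub>j q\<^bsub>j-1\<^esub>) = 1 / q\<^sub>j - 1 / q\<^bsub>j-1\<^esub>\<close>.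
\<close>
lemma tail_mass_dual_rho:
  assumes "k \<le> p"
  shows "tail_mass \<sigma> k = tail_mass \<rho> p / tail_mass \<rho> (p - k)"
  using assms
proof (induction k)
  case 0
  then show ?case using mass_pos[of p] by simp
next
  case (Suc k)
  define j where "j = p - Suc k"
  have j: "p - k = Suc j" "p + 1 - Suc k = Suc j" using Suc.prems by (auto simp: j_def)
  have q: "tail_mass \<rho> j > 0" "tail_mass \<rho> (Suc j) > 0" "tail_mass \<rho> p > 0"
    using mass_pos Suc.prems by (auto simp: j_def)
  have "\<rho> (Suc j) = tail_mass \<rho> j - tail_mass \<rho> (Suc j)" by (simp add: tail_mass_Suc)
  moreover have "\<sigma> (Suc k) = tail_mass \<rho> p * \<rho> (Suc j) / (tail_mass \<rho> (Suc j) * tail_mass \<rho> j)"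
    using \<sigma>[of "Suc k"] Suc.prems j by (simp add: dual_rho_def j_def)
  ultimately show ?case
    using Suc.IH Suc.prems q unfolding tail_mass_Suc[of \<sigma>] j j_def[symmetric] by (simp add: diff_divide_distrib right_diff_distrib)
qed

lemma dual_rho_pos: "j \<in> {1..p} \<Longrightarrow> \<sigma> j > 0"
  unfolding \<sigma> dual_rho_def using mass_pos
  by (intro divide_pos_pos mult_pos_pos \<rho>_rev_pos) auto

lemma tail_mass_dual_rho_all: "tail_mass \<sigma> p = tail_mass \<rho> p"
  using tail_mass_dual_rho[of p] by simp

lemma dual_rho_sum_less_1: "(\<Sum>i=1..p. \<sigma> i) < 1"
  using mass_pos[of p] tail_mass_dual_rho_all by (simp add: tail_mass_def)

lemma kraw_arg_dual_rho:
  assumes "j \<in> {1..p}"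
  shows "kraw_arg \<sigma> j = kraw_arg \<rho> (p + 1 - j)"
proof -
  have j: "p - (j - 1) = p + 1 - j" "p + 1 - j - 1 = p - j" using assms by auto
  have q: "tail_mass \<rho> (p + 1 - j) > 0" "tail_mass \<rho> (p - j) > 0" "tail_mass \<rho> p > 0" "\<rho> (p + 1 - j) > 0"
    using mass_pos \<rho>_rev_pos assms by auto
  have "kraw_arg \<sigma> j = tail_mass \<sigma> (j - 1) / \<sigma> j" using assms by (intro kraw_arg_tail_mass) auto
  also have "tail_mass \<sigma> (j - 1) = tail_mass \<rho> p / tail_mass \<rho> (p + 1 - j)"
    using assms tail_mass_dual_rho[of "j - 1"] by (simp only: j) auto
  finally have "kraw_arg \<sigma> j = tail_mass \<rho> (p - j) / \<rho> (p + 1 - j)"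
    unfolding \<sigma>[OF assms] dual_rho_def using q by (simp add: field_simps)
  moreover have "kraw_arg \<rho> (p + 1 - j) = tail_mass \<rho> (p + 1 - j - 1) / \<rho> (p + 1 - j)"
    using assms by (intro kraw_arg_tail_mass) auto
  ultimately show ?thesis by (simp only: j)
qed

text \<open>
The norm constants of one parameter are the reciprocals of the other parameter's weights, up to the
common factor \<open>q\<^sub>p\<close>.  Its powers cancel in the end because the weights of \<open>x\<close>, with the entry \<open>N - |x|\<close>
included, have total degree \<open>N\<close>.
\<close>
lemma kraw_scale_dual_rho:
  assumes "j \<in> {1..p}"
  shows "kraw_scale \<sigma> j * \<rho> (p + 1 - j) = tail_mass \<rho> p"
    and "kraw_scale \<rho> (p + 1 - j) * \<sigma> j = tail_mass \<rho> p"
proof -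
  have j: "p - (j - 1) = p + 1 - j" "p + 1 - j - 1 = p - j" using assms by auto
  have q: "tail_mass \<rho> (p + 1 - j) > 0" "tail_mass \<rho> (p - j) > 0" "tail_mass \<rho> p > 0" "\<rho> (p + 1 - j) > 0"
    using mass_pos \<rho>_rev_pos assms by auto
  have "kraw_scale \<sigma> j = tail_mass \<sigma> j * tail_mass \<sigma> (j - 1) / \<sigma> j"
    using assms by (intro kraw_scale_tail_mass) auto
  also have "tail_mass \<sigma> (j - 1) = tail_mass \<rho> p / tail_mass \<rho> (p + 1 - j)"
    using assms tail_mass_dual_rho[of "j - 1"] by (simp only: j) auto
  also have "tail_mass \<sigma> j = tail_mass \<rho> p / tail_mass \<rho> (p - j)"
    using assms by (intro tail_mass_dual_rho) auto
  finally show "kraw_scale \<sigma> j * \<rho> (p + 1 - j) = tail_mass \<rho> p"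
    unfolding \<sigma>[OF assms] dual_rho_def using q by (simp add: field_simps)
  have "kraw_scale \<rho> (p + 1 - j) = tail_mass \<rho> (p + 1 - j) * tail_mass \<rho> (p + 1 - j - 1) / \<rho> (p + 1 - j)"
    using assms by (intro kraw_scale_tail_mass) auto
  then show "kraw_scale \<rho> (p + 1 - j) * \<sigma> j = tail_mass \<rho> p"
    unfolding \<sigma>[OF assms] dual_rho_def j using q by (simp add: field_simps)
qed

text \<open>
Duality of \<open>kcoef\<close> exchanges the polynomials, and \<open>kraw_scale_dual_rho\<close> says that weights and norms are
exchanged in the same way; with the square root of the weight as factor, no constant is left over.
\<close>
theorem kraw_hat_duality:
  assumes x: "(\<Sum>i=1..p. x i) \<le> N" and \<nu>: "(\<Sum>i=1..p. \<nu> i) \<le> N"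
    and x': "\<And>j. j \<in> {1..p} \<Longrightarrow> x' j = x (p + 1 - j)"
    and \<nu>': "\<And>j. j \<in> {1..p} \<Longrightarrow> \<nu>' j = \<nu> (p + 1 - j)"
  shows "sqrt (kraw_weight p \<rho> N x) * kraw_hat p \<rho> N \<nu> (\<lambda>i. real (x i)) =
    sqrt (kraw_weight p \<sigma> N \<nu>') * kraw_hat p \<sigma> N x' (\<lambda>i. real (\<nu>' i))"
proof -
  define q where "q = tail_mass \<rho> p"
  have q: "q > 0" using mass_pos by (simp add: q_def)
  have sx: "(\<Sum>i=1..p. x' i) = (\<Sum>i=1..p. x i)"
    unfolding sum_rev[of x, symmetric] by (intro sum.cong refl x')
  have s\<nu>: "(\<Sum>i=1..p. \<nu>' i) = (\<Sum>i=1..p. \<nu> i)"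
    unfolding sum_rev[of \<nu>, symmetric] by (intro sum.cong refl \<nu>')
  have mult_rev: "multinom p N y' = multinom p N y"
    if "\<And>j. j \<in> {1..p} \<Longrightarrow> y' j = y (p + 1 - j)" for y y'
  proof -
    have "(\<Sum>i=1..p. y' i) = (\<Sum>i=1..p. y i)"
      unfolding sum_rev[of y, symmetric] by (intro sum.cong refl that)
    moreover have "(\<Prod>i=1..p. fact (y' i)) = (\<Prod>i=1..p. fact (y i) :: real)"
      unfolding prod_rev[of "\<lambda>i. fact (y i)", symmetric] by (intro prod.cong refl) (simp only: that)
    ultimately show ?thesis by (simp add: multinom_def)
  qed
  define mx m\<nu> where "mx = multinom p N x" and "m\<nu> = multinom p N \<nu>"
  have mx_rev: "mx = multinom p N x'" and m\<nu>_rev: "m\<nu> = multinom p N \<nu>'"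
    unfolding mx_def m\<nu>_def using x' \<nu>' by (auto intro: mult_rev[symmetric])
  have m: "mx > 0" "m\<nu> > 0" by (simp_all add: mx_def m\<nu>_def multinom_pos)
  define P C S C' where "P = (\<Prod>i=1..p. \<rho> i ^ x i)" and "C = (\<Prod>i=1..p. kraw_scale \<rho> i ^ \<nu> i)"
    and "S = (\<Prod>i=1..p. \<sigma> i ^ \<nu>' i)" and "C' = (\<Prod>i=1..p. kraw_scale \<sigma> i ^ x' i)"
  have "P > 0" "S > 0"
    unfolding P_def S_def using \<rho>(1) dual_rho_pos by (auto intro!: prod_pos zero_less_power)
  moreover have "C > 0" "C' > 0"
    unfolding C_def C'_def using kraw_scale_prod_pos[OF \<rho>] kraw_scale_prod_pos[OF dual_rho_pos dual_rho_sum_less_1]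
    by auto
  ultimately have pos: "P > 0" "S > 0" "C > 0" "C' > 0" by auto
  have "C' * P = (\<Prod>j=1..p. (kraw_scale \<sigma> j * \<rho> (p + 1 - j)) ^ x' j)"
    unfolding P_def C'_def prod_rev[of "\<lambda>i. \<rho> i ^ x i", symmetric] power_mult_distrib prod.distrib
    by (intro arg_cong2[where f = "(*)"] prod.cong refl) (simp only: x')
  also have "\<dots> = (\<Prod>j=1..p. q ^ x' j)"
    unfolding q_def by (intro prod.cong refl) (simp only: kraw_scale_dual_rho)
  finally have CP: "C' * P = q ^ (\<Sum>i=1..p. x i)" by (simp only: power_sum[symmetric] sx)
  have "C * S = (\<Prod>j=1..p. (kraw_scale \<rho> (p + 1 - j) * \<sigma> j) ^ \<nu>' j)"
    unfolding S_def C_def prod_rev[of "\<lambda>i. kraw_scale \<rho> i ^ \<nu> i", symmetric] power_mult_distrib prod.distrib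
    by (intro arg_cong2[where f = "(*)"] prod.cong refl) (simp only: \<nu>')
  also have "\<dots> = (\<Prod>j=1..p. q ^ \<nu>' j)"
    unfolding q_def by (intro prod.cong refl) (simp only: kraw_scale_dual_rho)
  finally have CS: "C * S = q ^ (\<Sum>i=1..p. \<nu> i)" by (simp only: power_sum[symmetric] s\<nu>)
  define A B where "A = q ^ (N - (\<Sum>i=1..p. x i))" and "B = q ^ (N - (\<Sum>i=1..p. \<nu> i))"
  have "C' * P * A = q ^ N" "C * S * B = q ^ N"
    unfolding CP CS A_def B_def using x \<nu> by (simp_all flip: power_add)
  then have key: "C' * P * A = C * S * B" by simp
  define K K' where "K = kcoef p (kraw_arg \<rho>) (real N) \<nu> (\<lambda>i. real (x i))"
    and "K' = kcoef p (kraw_arg \<sigma>) (real N) x' (\<lambda>i. real (\<nu>' i))"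
  have "mx * K = m\<nu> * K'"
    unfolding mx_def m\<nu>_def K_def K'_def using x \<nu> x' \<nu>' kraw_arg_dual_rho by (rule kcoef_duality)
  then have K: "K = m\<nu> / mx * K'" using m by (simp add: field_simps)
  \<comment> \<open>the ratio of the two unnormalized polynomials is absorbed into the square root\<close>
  have "sqrt (mx * P * A / (m\<nu> * C)) * (m\<nu> / mx) = sqrt (mx * P * A / (m\<nu> * C)) * sqrt ((m\<nu> / mx)\<^sup>2)"
    using m by simp
  also have "\<dots> = sqrt (mx * P * A / (m\<nu> * C) * (m\<nu> / mx)\<^sup>2)" by (simp only: real_sqrt_mult)
  also have "mx * P * A / (m\<nu> * C) * (m\<nu> / mx)\<^sup>2 = m\<nu> * S * B / (mx * C')"
    using m pos key by (simp add: field_simps power2_eq_square)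
  finally have r: "sqrt (mx * P * A / (m\<nu> * C)) * (m\<nu> / mx) = sqrt (m\<nu> * S * B / (mx * C'))" .
  have hat: "kraw_hat p \<rho> N \<nu> (\<lambda>i. real (x i)) = K / sqrt (m\<nu> * C)"
    unfolding K_def m\<nu>_def C_def using \<rho> \<nu> by (rule kraw_hat_eq_kcoef)
  have "(\<Sum>i=1..p. x' i) \<le> N" using x sx by simp
  then have hat': "kraw_hat p \<sigma> N x' (\<lambda>i. real (\<nu>' i)) = K' / sqrt (mx * C')"
    unfolding K'_def C'_def mx_rev by (intro kraw_hat_eq_kcoef dual_rho_pos dual_rho_sum_less_1)
  have weight: "kraw_weight p \<rho> N x = mx * P * A"
    by (simp only: kraw_weight_eq mx_def P_def A_def q_def tail_mass_def)
  have weight': "kraw_weight p \<sigma> N \<nu>' = m\<nu> * S * B"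
    unfolding kraw_weight_eq s\<nu> m\<nu>_rev[symmetric] tail_mass_def[symmetric] tail_mass_dual_rho_all
    by (simp only: S_def B_def q_def)
  have "sqrt (kraw_weight p \<rho> N x) * kraw_hat p \<rho> N \<nu> (\<lambda>i. real (x i)) = sqrt (mx * P * A) * (K / sqrt (m\<nu> * C))"
    by (simp only: weight hat)
  also have "\<dots> = sqrt (mx * P * A / (m\<nu> * C)) * (m\<nu> / mx) * K'"
    unfolding K real_sqrt_divide by (simp add: mult_ac)
  also have "\<dots> = sqrt (m\<nu> * S * B) * (K' / sqrt (mx * C'))"
    unfolding r unfolding real_sqrt_divide by simp
  finally show ?thesis by (simp only: weight' hat')
qed

end

section \<open>The cyclic permutation\<close>

lemma cycle_of_list_upt:
  assumes "j \<in> {1..d}"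
  shows "cycle_of_list [1..<d + 1] j = (if j < d then j + 1 else 1)"
proof -
  from assms obtain i where i: "j = Suc i" "i < d" by (cases j) auto
  have len: "length [1..<d + 1] = d" by simp
  have "map (cycle_of_list [1..<d + 1]) [1..<d + 1] = rotate1 [1..<d + 1]"
    using cyclic_rotation[of "[1..<d + 1]" 1] by simp
  then have "map (cycle_of_list [1..<d + 1]) [1..<d + 1] ! i = rotate1 [1..<d + 1] ! i"
    by (rule arg_cong)
  also have "\<dots> = [1..<d + 1] ! (Suc i mod d)"
    using i len by (subst nth_rotate1) (simp_all only:)
  also have "map (cycle_of_list [1..<d + 1]) [1..<d + 1] ! i = cycle_of_list [1..<d + 1] ([1..<d + 1] ! i)"
    using i len by (intro nth_map) (simp only:)
  also have "[1..<d + 1] ! i = j"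
    using i by (subst nth_upt) auto
  also have "[1..<d + 1] ! (Suc i mod d) = 1 + Suc i mod d"
    using i by (intro nth_upt) auto
  finally show ?thesis using i by (cases "Suc i = d") auto
qed

section \<open>The linear substitution\<close>

text \<open>
The factor \<open>\<kappa>\<^sub>j\<close> in front of the \<open>j\<close>-th form below.  In general it is \<open>1 / q\<^sub>j - 1 / q\<^bsub>j-1\<^esub>\<close>, from the
difference of two consecutive partial sums of the forms; the first form has no predecessor.
\<close>
definition conn_factor :: "(nat \<Rightarrow> real) \<Rightarrow> nat \<Rightarrow> real" where
  "conn_factor \<rho> j = (if j = 1 then 1 / tail_mass \<rho> 1 else \<rho> j / (tail_mass \<rho> j * tail_mass \<rho> (j - 1)))"

text \<open>
The vector \<open>u = R s\<close> that solves \<open>l\<^sub>j(s; \<tau>\<rho>) = l\<^bsub>\<tau>(j)\<^esub>(u; \<rho>)\<close> for all \<open>j\<close>, together with \<open>\<Sum>s = \<Sum>u\<close>.  All forms being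
homogeneous, the last variable is fixed by \<open>q\<^sub>d s\<^sub>d = 1\<close> with \<open>d = p + 1\<close>, which accounts for the constant 1.
\<close>
definition conn_form :: "nat \<Rightarrow> (nat \<Rightarrow> real) \<Rightarrow> (nat \<Rightarrow> real) \<Rightarrow> nat \<Rightarrow> real" where
  "conn_form p \<rho> s j = conn_factor \<rho> j * (1 - \<rho> 1 * (\<Sum>i\<in>{j..p}. s i) +
     (if j = 1 then 0 else tail_mass \<rho> j * (tail_mass \<rho> (j - 1) + \<rho> 1) / \<rho> j * s (j - 1)))"

text \<open>
The coefficient of \<open>s\<^sup>\<nu>\<close> in \<open>\<Prod>\<^sub>j u\<^sub>j\<^bsup>\<mu>\<^sub>j\<^esup>\<close>, once the constant 1 in \<open>u\<close> is written as \<open>q\<^sub>d s\<^sub>d\<close> again.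
\<close>
definition conn_coef :: "nat \<Rightarrow> (nat \<Rightarrow> real) \<Rightarrow> nat \<Rightarrow> (nat \<Rightarrow> nat) \<Rightarrow> (nat \<Rightarrow> nat) \<Rightarrow> real" where
  "conn_coef p \<rho> n \<nu> \<mu> = (\<Prod>j=1..Suc p. conn_factor \<rho> j ^ \<mu> j) *
     (- \<rho> 1) ^ (\<Sum>i=1..p. \<nu> i) * tail_mass \<rho> (Suc p) ^ \<nu> (Suc p) *
     kcoef p (kraw_arg (rho_tilde (Suc p) \<rho>)) (real n) (\<lambda>j. \<nu> (Suc p - j)) (\<lambda>j. real (\<mu> (Suc p + 1 - j)))"

context
  fixes p :: nat and \<rho> :: "nat \<Rightarrow> real"
  assumes p: "p \<ge> 1"
    and \<rho>: "\<And>i. i \<in> {1..Suc p} \<Longrightarrow> \<rho> i > 0" "(\<Sum>i=1..Suc p. \<rho> i) < 1"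
begin

private abbreviation (input) "q \<equiv> tail_mass \<rho>"

private abbreviation (input) "\<rho>' \<equiv> rho_tilde (Suc p) \<rho>"

private lemma q_pos: "j \<le> Suc p \<Longrightarrow> q j > 0"
  using tail_mass_pos[OF \<rho>] by simp

private lemma \<rho>_pos: "\<rho> 1 > 0" "j \<le> p \<Longrightarrow> \<rho> (Suc j) > 0"
  using \<rho>(1) by auto

lemma kraw_arg_eq: "j \<le> p \<Longrightarrow> 1 - kraw_arg \<rho> (Suc j) = - q (Suc j) / \<rho> (Suc j)"
  using \<rho>_pos(2)[of j] by (simp add: kraw_arg_tail_mass tail_mass_Suc field_simps)

lemma rho_tilde_eq:
  assumes "k \<le> p" "k \<ge> 1"
  shows "\<rho>' (Suc p - k) = \<rho> 1 * \<rho> (Suc k) * q (Suc p) / (q k * q (Suc k) * (q (Suc p) + \<rho> 1))"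
proof -
  have "Suc p - (Suc p - k) = k" "Suc p + 1 - (Suc p - k) = Suc k" using assms by auto
  then show ?thesis
    unfolding rho_tilde_def tail_mass_def by (simp only: add_diff_eq add.commute)
qed

text \<open>
As for the dual parameter, the partial sums telescope:
\<open>\<rho>\<^sub>j / (q\<^sub>j q\<^bsub>j-1\<^esub>)\<close> is a difference of reciprocals, and the other factors do not depend on \<open>j\<close>.
\<close>
lemma tail_mass_rho_tilde:
  assumes "m \<le> p"
  shows "tail_mass \<rho>' m = q (Suc p) * (q (Suc p - m) + \<rho> 1) / (q (Suc p - m) * (q (Suc p) + \<rho> 1))"
  using assms
proof (induction m)
  case 0
  then show ?case using q_pos[of "Suc p"] \<rho>_pos(1) by (simp add: tail_mass_def[of \<rho>'])
next
  case (Suc m)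
  define k where "k = p - m"
  have k: "Suc p - m = Suc k" "Suc p - Suc m = k" "1 \<le> k" "k \<le> p" "Suc m = Suc p - k"
    using Suc.prems by (auto simp: k_def)
  have pos: "q k > 0" "q (Suc k) > 0" "q (Suc p) + \<rho> 1 > 0"
    using q_pos k \<rho>_pos(1) by (auto intro: add_pos_pos)
  have r: "\<rho> (Suc k) = q k - q (Suc k)" by (simp add: tail_mass_Suc)
  have "\<rho>' (Suc m) = \<rho> 1 * \<rho> (Suc k) * q (Suc p) / (q k * q (Suc k) * (q (Suc p) + \<rho> 1))"
    using rho_tilde_eq[OF k(4,3)] by (simp only: k(5))
  moreover have "tail_mass \<rho>' m = q (Suc p) * (q (Suc k) + \<rho> 1) / (q (Suc k) * (q (Suc p) + \<rho> 1))"
    using Suc k by simp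
  moreover have "a * (y + c) / (y * (a + c)) - c * (x - y) * a / (x * y * (a + c)) = a * (x + c) / (x * (a + c))"
    if "a + c > 0" "x > 0" "y > 0" for a c x y :: real
    using that by (simp add: divide_simps) (simp add: algebra_simps)
  ultimately show ?case
    unfolding tail_mass_Suc[of \<rho>'] k(2) r using pos by simp
qed

lemma rho_tilde_pos: "j \<in> {1..p} \<Longrightarrow> \<rho>' j > 0"
  using rho_tilde_eq[of "Suc p - j"] q_pos[of "Suc p"] q_pos[of "Suc p - j"] q_pos[of "Suc (Suc p - j)"]
    \<rho>_pos(1) \<rho>_pos(2)[of "Suc p - j"]
  by (auto intro!: divide_pos_pos mult_pos_pos add_pos_pos)

lemma rho_tilde_sum_less_1: "(\<Sum>i=1..p. \<rho>' i) < 1"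
proof -
  have "tail_mass \<rho>' p > 0"
    unfolding tail_mass_rho_tilde[OF order_refl] using q_pos[of "Suc p"] q_pos[of "Suc p - p"] \<rho>_pos(1) p
    by (intro divide_pos_pos mult_pos_pos add_pos_pos) auto
  then show ?thesis by (simp add: tail_mass_def)
qed

text \<open>
These are the coefficients that occur in \<open>conn_form\<close>, up to the scaling of the variables by \<open>- \<rho>\<^sub>1\<close>.
\<close>
lemma kraw_arg_rho_tilde:
  assumes k: "k \<in> {1..p}"
  shows "1 - kraw_arg \<rho>' (Suc p - k) = - q (Suc k) * (q k + \<rho> 1) / (\<rho> 1 * \<rho> (Suc k))"
proof -
  have eq: "kraw_arg \<rho>' (Suc p - k) = tail_mass \<rho>' (p - k) / \<rho>' (Suc p - k)"
    using k kraw_arg_tail_mass[of "Suc p - k" \<rho>'] by (simp add: Suc_diff_le)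
  have t: "tail_mass \<rho>' (p - k) = q (Suc p) * (q (Suc k) + \<rho> 1) / (q (Suc k) * (q (Suc p) + \<rho> 1))"
    using tail_mass_rho_tilde[of "p - k"] k by (simp add: Suc_diff_le)
  have r: "\<rho>' (Suc p - k) = \<rho> 1 * \<rho> (Suc k) * q (Suc p) / (q k * q (Suc k) * (q (Suc p) + \<rho> 1))"
    using k by (intro rho_tilde_eq) auto
  have pos: "q k > 0" "q (Suc k) > 0" "q (Suc p) > 0" "\<rho> 1 > 0" "\<rho> (Suc k) > 0" "q (Suc p) + \<rho> 1 > 0"
    using q_pos \<rho>_pos k by (auto intro: add_pos_pos)
  have "kraw_arg \<rho>' (Suc p - k) = q k * (q (Suc k) + \<rho> 1) / (\<rho> 1 * \<rho> (Suc k))"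
    unfolding eq t r using pos by (simp add: divide_simps)
  then show ?thesis
    using pos tail_mass_Suc[of \<rho> k] by (simp add: divide_simps) (simp add: algebra_simps)
qed

private abbreviation (input) "u \<equiv> conn_form p \<rho>"

lemma conn_form_1: "u s 1 = (1 - \<rho> 1 * (\<Sum>i=1..p. s i)) / q 1"
  by (simp add: conn_form_def conn_factor_def)

lemma conn_form_Suc:
  assumes "j \<ge> 1"
  shows "u s (Suc j) = conn_factor \<rho> (Suc j) *
    (1 - \<rho> 1 * (\<Sum>i\<in>{j<..p}. s i) + q (Suc j) * (q j + \<rho> 1) / \<rho> (Suc j) * s j)"
proof -
  have "{Suc j..p} = {j<..p}" by auto
  then show ?thesis using assms by (simp add: conn_form_def)
qed

text \<open>
The partial sums of \<open>u\<close> have a simpler shape than its entries; it is found by adding up the equations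
\<open>q\<^sub>j V\<^sub>j - q\<^bsub>j+1\<^esub> V\<^bsub>j+1\<^esub> = \<rho>\<^bsub>j+1\<^esub> S\<^bsub>j-1\<^esub> - (q\<^bsub>j+1\<^esub> + \<rho>\<^sub>1) s\<^sub>j\<close> that the substitution has to satisfy for
\<open>V\<^sub>j = u\<^sub>1 + \<dots> + u\<^sub>j\<close>.
\<close>
lemma sum_conn_form:
  assumes "j \<in> {1..Suc p}"
  shows "(\<Sum>i=1..j. u s i) = (\<Sum>i\<in>{1..<j}. s i) + (1 - \<rho> 1 * (\<Sum>i\<in>{j..p}. s i)) / q j"
proof -
  have "j \<ge> 1" using assms by simp
  then show ?thesis using assms
  proof (induction j rule: dec_induct)
    case base
    then show ?case by (simp add: conn_form_1[unfolded One_nat_def])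
  next
    case (step j)
    define m where "m = 1 - \<rho> 1 * (\<Sum>i\<in>{Suc j..p}. s i)"
    have pos: "q j > 0" "q (Suc j) > 0" "\<rho> (Suc j) > 0"
      using step.prems q_pos \<rho>_pos by auto
    have r: "\<rho> (Suc j) = q j - q (Suc j)" by (simp add: tail_mass_Suc)
    have "{j..p} = insert j {Suc j..p}" using step.prems by auto
    then have m: "1 - \<rho> 1 * (\<Sum>i\<in>{j..p}. s i) = m - \<rho> 1 * s j" by (simp add: m_def algebra_simps)
    have ivl: "{j<..p} = {Suc j..p}" by auto
    have "u s (Suc j) = \<rho> (Suc j) / (q (Suc j) * q j) * (m + q (Suc j) * (q j + \<rho> 1) / \<rho> (Suc j) * s j)"
      unfolding conn_form_Suc[OF step.hyps(1)] m_def ivl using step.hyps by (simp add: conn_factor_def)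
    also have "\<dots> = s j + m / q (Suc j) - (m - \<rho> 1 * s j) / q j"
      using pos r by (simp add: divide_simps) (simp add: algebra_simps)
    finally have "u s (Suc j) = \<dots>" .
    moreover have "(\<Sum>i=1..j. u s i) = (\<Sum>i\<in>{1..<j}. s i) + (m - \<rho> 1 * s j) / q j"
      using step m by simp
    ultimately show ?case
      using step.hyps m_def by simp
  qed
qed

text \<open>
With \<open>y\<^sub>i = - \<rho>\<^sub>1 s\<^sub>i\<close>, the form \<open>u\<^sub>1\<close> is \<open>\<kappa>\<^sub>1 (1 + \<Sum>y)\<close> and \<open>u\<^bsub>j+1\<^esub>\<close> is \<open>\<kappa>\<^bsub>j+1\<^esub>\<close> times the \<open>j\<close>-th factor of the
reversed generating function with parameter \<open>\<rho>\<close>-tilde.  So \<open>u\<^sup>\<mu>\<close> is that generating function for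
\<open>N = n\<close> at the point \<open>(\<mu>\<^sub>d, \<dots>, \<mu>\<^sub>2)\<close>, with \<open>\<mu>\<^sub>1\<close> as the remaining exponent.
\<close>
lemma conn_form_power_expansion:
  assumes \<mu>: "\<mu> \<in> multi_indices (Suc p) n"
  shows "(\<Prod>j=1..Suc p. u s j ^ \<mu> j) = (\<Sum>\<nu>\<in>grid p n. (\<Prod>j=1..Suc p. conn_factor \<rho> j ^ \<mu> j) *
     (- \<rho> 1) ^ (\<Sum>i=1..p. \<nu> i) *
     kcoef p (kraw_arg \<rho>') (real n) (\<lambda>j. \<nu> (Suc p - j)) (\<lambda>j. real (\<mu> (Suc p + 1 - j))) * (\<Prod>i=1..p. s i ^ \<nu> i))"
proof -
  have split: "(\<Prod>j=1..Suc p. f j) = f 1 * (\<Prod>j=1..p. f (Suc j))" for f :: "nat \<Rightarrow> real"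
    unfolding prod.shift_bounds_cl_Suc_ivl[symmetric] by (simp add: prod.atLeast_Suc_atMost)
  have "(\<Sum>j=1..Suc p. \<mu> j) = \<mu> 1 + (\<Sum>j=1..p. \<mu> (Suc j))"
    unfolding sum.shift_bounds_cl_Suc_ivl[symmetric] by (simp add: sum.atLeast_Suc_atMost)
  then have \<mu>1: "\<mu> 1 = n - (\<Sum>j=1..p. \<mu> (Suc j))" and le: "(\<Sum>j=1..p. \<mu> (Suc j)) \<le> n"
    using \<mu> by (auto simp: multi_indices_def)
  let ?z = "\<lambda>j. kraw_arg \<rho>' (Suc p - j)"
  let ?y = "\<lambda>i. - \<rho> 1 * s i"
  have "(\<Sum>\<nu>\<in>grid p n. (- \<rho> 1) ^ (\<Sum>i=1..p. \<nu> i) *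
     kcoef p (kraw_arg \<rho>') (real n) (\<lambda>j. \<nu> (Suc p - j)) (\<lambda>j. real (\<mu> (Suc p + 1 - j))) * (\<Prod>i=1..p. s i ^ \<nu> i)) =
     (\<Sum>\<nu>\<in>grid p n. kcoef p (\<lambda>j. ?z (p + 1 - j)) (real n) (rev_index p \<nu>) (\<lambda>i. real (\<mu> (Suc (p + 1 - i)))) *
       (\<Prod>i=1..p. ?y i ^ \<nu> i))"
  proof (intro sum.cong refl)
    fix \<nu>
    have "kcoef p (kraw_arg \<rho>') (real n) (\<lambda>j. \<nu> (Suc p - j)) (\<lambda>j. real (\<mu> (Suc p + 1 - j))) =
      kcoef p (\<lambda>j. ?z (p + 1 - j)) (real n) (rev_index p \<nu>) (\<lambda>i. real (\<mu> (Suc (p + 1 - i))))"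
      by (rule kcoef_cong) (auto simp: rev_index_def Suc_diff_le)
    then show "(- \<rho> 1) ^ (\<Sum>i=1..p. \<nu> i) *
     kcoef p (kraw_arg \<rho>') (real n) (\<lambda>j. \<nu> (Suc p - j)) (\<lambda>j. real (\<mu> (Suc p + 1 - j))) * (\<Prod>i=1..p. s i ^ \<nu> i) =
      kcoef p (\<lambda>j. ?z (p + 1 - j)) (real n) (rev_index p \<nu>) (\<lambda>i. real (\<mu> (Suc (p + 1 - i)))) *
       (\<Prod>i=1..p. ?y i ^ \<nu> i)"
      by (simp only: power_mult_distrib prod.distrib power_sum mult_ac)
  qed
  also have "\<dots> = (\<Prod>j=1..p. (1 + (\<Sum>i\<in>{j<..p}. ?y i) + (1 - ?z j) * ?y j) ^ \<mu> (Suc j)) *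
      (1 + (\<Sum>i=1..p. ?y i)) ^ (n - (\<Sum>i=1..p. \<mu> (Suc i)))"
    using le by (rule kcoef_generating_function_rev)
  finally have gen: "(\<Sum>\<nu>\<in>grid p n. (- \<rho> 1) ^ (\<Sum>i=1..p. \<nu> i) *
     kcoef p (kraw_arg \<rho>') (real n) (\<lambda>j. \<nu> (Suc p - j)) (\<lambda>j. real (\<mu> (Suc p + 1 - j))) * (\<Prod>i=1..p. s i ^ \<nu> i)) = \<dots>" .
  have u1: "u s 1 = conn_factor \<rho> 1 * (1 + (\<Sum>i=1..p. ?y i))"
    unfolding conn_form_1 sum_distrib_left[symmetric] by (simp add: conn_factor_def)
  have u2: "u s (Suc j) = conn_factor \<rho> (Suc j) * (1 + (\<Sum>i\<in>{j<..p}. ?y i) + (1 - ?z j) * ?y j)" if "j \<in> {1..p}" for j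
  proof -
    have "\<rho> 1 > 0" "\<rho> (Suc j) > 0" using \<rho>_pos that by auto
    then have "(1 - ?z j) * ?y j = q (Suc j) * (q j + \<rho> 1) / \<rho> (Suc j) * s j"
      unfolding kraw_arg_rho_tilde[OF that] by (simp add: field_simps)
    then show ?thesis
      using conn_form_Suc[of j s] that unfolding sum_distrib_left[symmetric] by simp
  qed
  have "(\<Prod>j=1..Suc p. u s j ^ \<mu> j) = (\<Prod>j=1..Suc p. conn_factor \<rho> j ^ \<mu> j) *
     ((\<Prod>j=1..p. (1 + (\<Sum>i\<in>{j<..p}. ?y i) + (1 - ?z j) * ?y j) ^ \<mu> (Suc j)) *
      (1 + (\<Sum>i=1..p. ?y i)) ^ \<mu> 1)"
  proof -
    have "(\<Prod>j=1..p. u s (Suc j) ^ \<mu> (Suc j)) =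
      (\<Prod>j=1..p. (conn_factor \<rho> (Suc j) * (1 + (\<Sum>i\<in>{j<..p}. ?y i) + (1 - ?z j) * ?y j)) ^ \<mu> (Suc j))"
      by (intro prod.cong refl) (simp only: u2)
    then show ?thesis
      unfolding split u1 by (simp only: power_mult_distrib prod.distrib mult_ac)
  qed
  then show ?thesis
    unfolding \<mu>1[symmetric] gen[symmetric] unfolding \<mu>1 gen[symmetric] sum_distrib_left by (simp only: mult.assoc)
qed

section \<open>Normalization\<close>

text \<open>
The scaling factors of the substitution and the norm constants of \<open>\<rho>\<close> combine to the weights of
\<open>\<rho>\<close>-tilde, up to the constant \<open>\<omega> = \<rho>\<^sub>1 q\<^sub>d / (q\<^sub>d + \<rho>\<^sub>1)\<close>.  The same constant appears in \<open>kraw_scale_\<tau>\<close>, and since both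
\<open>|\<mu>|\<close> and \<open>|\<nu>|\<close> equal \<open>n\<close> it cancels.
\<close>
lemma conn_factor_scale:
  "j \<in> {1..p} \<Longrightarrow> (conn_factor \<rho> (Suc j))\<^sup>2 * kraw_scale \<rho> (Suc j) * (\<rho> 1 * q (Suc p) / (q (Suc p) + \<rho> 1)) = \<rho>' (Suc p - j)"
  "(conn_factor \<rho> 1)\<^sup>2 * kraw_scale \<rho> 1 * (\<rho> 1 * q (Suc p) / (q (Suc p) + \<rho> 1)) = tail_mass \<rho>' p"
proof -
  assume j: "j \<in> {1..p}"
  have pos: "q j > 0" "q (Suc j) > 0" "q (Suc p) > 0" "\<rho> 1 > 0" "\<rho> (Suc j) > 0" "q (Suc p) + \<rho> 1 > 0"
    using q_pos \<rho>_pos j by (auto intro: add_pos_pos)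
  have r: "\<rho>' (Suc p - j) = \<rho> 1 * \<rho> (Suc j) * q (Suc p) / (q j * q (Suc j) * (q (Suc p) + \<rho> 1))"
    using j by (intro rho_tilde_eq) auto
  have c: "kraw_scale \<rho> (Suc j) = q (Suc j) * q j / \<rho> (Suc j)"
    by (simp add: kraw_scale_tail_mass)
  have k: "conn_factor \<rho> (Suc j) = \<rho> (Suc j) / (q (Suc j) * q j)"
    using j by (simp add: conn_factor_def)
  show "(conn_factor \<rho> (Suc j))\<^sup>2 * kraw_scale \<rho> (Suc j) * (\<rho> 1 * q (Suc p) / (q (Suc p) + \<rho> 1)) = \<rho>' (Suc p - j)"
    unfolding r c k power2_eq_square using pos by (simp add: divide_simps)
next
  have pos: "q 1 > 0" "q (Suc p) > 0" "\<rho> 1 > 0" "q (Suc p) + \<rho> 1 > 0"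
    using q_pos[of 1] q_pos[of "Suc p"] \<rho>_pos by (auto intro: add_pos_pos)
  have t: "tail_mass \<rho>' p = q (Suc p) * (q 1 + \<rho> 1) / (q 1 * (q (Suc p) + \<rho> 1))"
    using tail_mass_rho_tilde[OF order_refl] by simp
  have q1: "q 1 + \<rho> 1 = 1" by (simp add: tail_mass_def)
  have c: "kraw_scale \<rho> 1 = q 1 / \<rho> 1"
    by (simp add: kraw_scale_tail_mass)
  have k: "conn_factor \<rho> 1 = 1 / q 1"
    by (simp add: conn_factor_def)
  show "(conn_factor \<rho> 1)\<^sup>2 * kraw_scale \<rho> 1 * (\<rho> 1 * q (Suc p) / (q (Suc p) + \<rho> 1)) = tail_mass \<rho>' p"
    unfolding t q1 c k power2_eq_square using pos by (simp add: divide_simps)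
qed

lemma multinom_Suc:
  assumes "n \<le> N" "(\<Sum>i=1..Suc p. x i) = n" "(\<Prod>i=1..p. fact (y i)) * fact (n - (\<Sum>i=1..p. y i)) = (\<Prod>i=1..Suc p. fact (x i) :: real)"
  shows "multinom (Suc p) N x = real (N choose n) * multinom p n y"
  using assms by (simp add: multinom_def binomial_fact field_simps)

text \<open>
This is why the two formulas are equivalent.
\<close>
lemma rho_hat_eq_dual_rho_tilde:
  assumes "j \<in> {1..p}"
  shows "rho_hat \<rho> j = dual_rho p \<rho>' j"
proof -
  have pos: "q 1 > 0" "q j > 0" "q (Suc j) > 0" "q (Suc p) > 0" "\<rho> 1 > 0" "\<rho> (Suc j) > 0"
    "q (Suc p) + \<rho> 1 > 0" "q j + \<rho> 1 > 0" "q (Suc j) + \<rho> 1 > 0"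
    using q_pos[of 1] q_pos[of j] q_pos[of "Suc j"] q_pos[of "Suc p"] \<rho>_pos assms by (auto intro: add_pos_pos)
  have idx: "p + 1 - j = Suc p - j" by simp
  have r: "\<rho>' (Suc p - j) = \<rho> 1 * \<rho> (Suc j) * q (Suc p) / (q j * q (Suc j) * (q (Suc p) + \<rho> 1))"
    using assms by (intro rho_tilde_eq) auto
  have t1: "tail_mass \<rho>' (Suc p - j) = q (Suc p) * (q j + \<rho> 1) / (q j * (q (Suc p) + \<rho> 1))"
    using tail_mass_rho_tilde[of "Suc p - j"] assms
    by (simp only: diff_diff_cancel[of j "Suc p"] atLeastAtMost_iff) auto
  have t2: "tail_mass \<rho>' (p - j) = q (Suc p) * (q (Suc j) + \<rho> 1) / (q (Suc j) * (q (Suc p) + \<rho> 1))"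
    using tail_mass_rho_tilde[of "p - j"] assms by (simp add: Suc_diff_le)
  have t: "tail_mass \<rho>' p = q (Suc p) / (q 1 * (q (Suc p) + \<rho> 1))"
  proof -
    have "q 1 + \<rho> 1 = 1" by (simp add: tail_mass_def)
    then show ?thesis using tail_mass_rho_tilde[OF order_refl] by simp
  qed
  have "rho_hat \<rho> j = \<rho> 1 * \<rho> (Suc j) / (q 1 * (q (Suc j) + \<rho> 1) * (q j + \<rho> 1))"
    by (simp add: rho_hat_def tail_mass_def algebra_simps)
  then show ?thesis
    unfolding dual_rho_def idx r t1 t2 t using pos by (simp add: divide_simps mult_ac)
qed

context
  fixes \<tau> :: "nat \<Rightarrow> nat"
  assumes \<tau>_less: "\<And>j. j \<in> {1..p} \<Longrightarrow> \<tau> j = Suc j"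
    and \<tau>_last: "\<tau> (Suc p) = 1"
begin

lemma bij_\<tau>: "bij_betw \<tau> {1..Suc p} {1..Suc p}"
proof (rule bij_betwI[where g = "\<lambda>j. if j = 1 then Suc p else j - 1"])
  show "\<tau> (if j = 1 then Suc p else j - 1) = j" if "j \<in> {1..Suc p}" for j
    using that \<tau>_last \<tau>_less by (cases j) auto
qed (auto simp: \<tau>_less \<tau>_last le_Suc_eq)

lemma sum_\<tau>: "(\<Sum>i=1..Suc p. f (\<tau> i)) = (\<Sum>i=1..Suc p. f i)"
  by (rule sum.reindex_bij_betw[OF bij_\<tau>])

lemma prod_\<tau>: "(\<Prod>i=1..Suc p. f (\<tau> i)) = (\<Prod>i=1..Suc p. f i)"
  by (rule prod.reindex_bij_betw[OF bij_\<tau>])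

lemma tail_mass_\<tau>: "j \<le> p \<Longrightarrow> tail_mass (\<rho> \<circ> \<tau>) j = q (Suc j) + \<rho> 1"
proof (induction j)
  case 0
  show ?case by (simp add: tail_mass_def)
next
  case (Suc j)
  then show ?case
    using \<tau>_less[of "Suc j"] by (simp add: tail_mass_Suc)
qed

lemma tail_mass_\<tau>_all: "tail_mass (\<rho> \<circ> \<tau>) (Suc p) = q (Suc p)"
  using sum_\<tau>[of \<rho>] by (simp only: tail_mass_def o_def)

text \<open>
Apart from the last position, \<open>\<tau>\<rho>\<close> is \<open>\<rho>\<close> shifted by one, so its tail masses are those of \<open>\<rho>\<close> with
\<open>\<rho>\<^sub>1\<close> added back.
\<close>
lemma kraw_arg_\<tau>:
  "j \<in> {1..p} \<Longrightarrow> 1 - kraw_arg (\<rho> \<circ> \<tau>) j = - (q (Suc j) + \<rho> 1) / \<rho> (Suc j)"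
  "1 - kraw_arg (\<rho> \<circ> \<tau>) (Suc p) = - q (Suc p) / \<rho> 1"
proof -
  assume j: "j \<in> {1..p}"
  have "kraw_arg (\<rho> \<circ> \<tau>) j = tail_mass (\<rho> \<circ> \<tau>) (j - 1) / (\<rho> \<circ> \<tau>) j"
    using j by (intro kraw_arg_tail_mass) auto
  also have "tail_mass (\<rho> \<circ> \<tau>) (j - 1) = q j + \<rho> 1" using tail_mass_\<tau>[of "j - 1"] j by auto
  also have "(\<rho> \<circ> \<tau>) j = \<rho> (Suc j)" using \<tau>_less[OF j] by simp
  finally have *: "kraw_arg (\<rho> \<circ> \<tau>) j = (q j + \<rho> 1) / \<rho> (Suc j)" .
  show "1 - kraw_arg (\<rho> \<circ> \<tau>) j = - (q (Suc j) + \<rho> 1) / \<rho> (Suc j)"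
    unfolding * tail_mass_Suc using \<rho>_pos(2)[of j] j by (simp add: field_simps)
next
  have "kraw_arg (\<rho> \<circ> \<tau>) (Suc p) = tail_mass (\<rho> \<circ> \<tau>) (Suc p - 1) / (\<rho> \<circ> \<tau>) (Suc p)"
    by (intro kraw_arg_tail_mass) auto
  also have "\<dots> = (q (Suc p) + \<rho> 1) / \<rho> 1"
    using tail_mass_\<tau>[of p] \<tau>_last by simp
  finally show "1 - kraw_arg (\<rho> \<circ> \<tau>) (Suc p) = - q (Suc p) / \<rho> 1"
    using \<rho>_pos(1) by (simp add: field_simps)
qed

text \<open>
The defining property of the substitution.  For \<open>j < d\<close> it is a relation between \<open>V\<^sub>j\<close> and \<open>u\<^bsub>j+1\<^esub>\<close>; for
\<open>j = d\<close> it determines \<open>u\<^sub>1\<close>.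
\<close>
lemma conn_form_substitution:
  assumes s: "s (Suc p) = 1 / q (Suc p)" and j: "j \<in> {1..Suc p}"
  shows "(\<Sum>i\<in>{1..<j}. s i) + (1 - kraw_arg (\<rho> \<circ> \<tau>) j) * s j =
    (\<Sum>i\<in>{1..<\<tau> j}. u s i) + (1 - kraw_arg \<rho> (\<tau> j)) * u s (\<tau> j)"
proof (cases "j = Suc p")
  case True
  have pos: "q 1 > 0" "q (Suc p) > 0" "\<rho> 1 > 0" using q_pos[of 1] q_pos \<rho>_pos by auto
  have "{1..<Suc p} = {1..p}" by auto
  moreover have "1 - kraw_arg \<rho> 1 = - q 1 / \<rho> 1" using kraw_arg_eq[of 0] by simp
  ultimately show ?thesis
    unfolding True \<tau>_last kraw_arg_\<tau>(2) s conn_form_1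
    using pos by (simp only:) (simp add: field_simps)
next
  case False
  then have j: "j \<in> {1..p}" using assms by auto
  define m where "m = 1 - \<rho> 1 * (\<Sum>i\<in>{j<..p}. s i)"
  have pos: "q j > 0" "q (Suc j) > 0" "\<rho> (Suc j) > 0"
    using j q_pos \<rho>_pos by auto
  have r: "\<rho> (Suc j) = q j - q (Suc j)" by (simp add: tail_mass_Suc)
  have "{j..p} = insert j {j<..p}" using j by auto
  then have m: "1 - \<rho> 1 * (\<Sum>i\<in>{j..p}. s i) = m - \<rho> 1 * s j" by (simp add: m_def algebra_simps)
  have ivl: "{1..<Suc j} = {1..j}" by auto
  have "u s (Suc j) = \<rho> (Suc j) / (q (Suc j) * q j) * (m + q (Suc j) * (q j + \<rho> 1) / \<rho> (Suc j) * s j)"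
    using j conn_form_Suc[of j s] by (simp add: conn_factor_def m_def)
  moreover have "(\<Sum>i=1..j. u s i) = (\<Sum>i\<in>{1..<j}. s i) + (m - \<rho> 1 * s j) / q j"
    using sum_conn_form[of j s] j m by simp
  moreover have "1 - kraw_arg \<rho> (Suc j) = - q (Suc j) / \<rho> (Suc j)"
    using j by (intro kraw_arg_eq) auto
  moreover have "- (q (Suc j) + \<rho> 1) / \<rho> (Suc j) * s j = (m - \<rho> 1 * s j) / q j +
     - q (Suc j) / \<rho> (Suc j) * (\<rho> (Suc j) / (q (Suc j) * q j) * (m + q (Suc j) * (q j + \<rho> 1) / \<rho> (Suc j) * s j))"
    using pos r by (simp add: divide_simps) (simp add: algebra_simps)
  ultimately show ?thesis
    unfolding \<tau>_less[OF j] kraw_arg_\<tau>(1)[OF j] ivl by simp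
qed

text \<open>
Permuting the factors of the generating function for \<open>\<tau>\<rho>\<close> turns it into the one for \<open>\<rho>\<close> at \<open>u\<close>.
\<close>
lemma kcoef_connection_generating_function:
  assumes s: "s (Suc p) = 1 / q (Suc p)"
  shows "(\<Sum>\<nu>\<in>multi_indices (Suc p) n. kcoef (Suc p) (kraw_arg (\<rho> \<circ> \<tau>)) N \<nu> (\<alpha> \<circ> \<tau>) * (\<Prod>i=1..Suc p. s i ^ \<nu> i)) =
    (\<Sum>\<mu>\<in>multi_indices (Suc p) n. kcoef (Suc p) (kraw_arg \<rho>) N \<mu> \<alpha> * (\<Prod>i=1..Suc p. u s i ^ \<mu> i))"
proof -
  let ?l = "\<lambda>j. (\<Sum>i\<in>{1..<j}. u s i) + (1 - kraw_arg \<rho> j) * u s j"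
  have "(\<Prod>j=1..Suc p. bpow ((\<Sum>i\<in>{1..<j}. s i) + (1 - kraw_arg (\<rho> \<circ> \<tau>) j) * s j) ((\<alpha> \<circ> \<tau>) j)) =
     (\<Prod>j=1..Suc p. bpow (?l (\<tau> j)) (\<alpha> (\<tau> j)))"
    by (intro prod.cong refl) (simp only: conn_form_substitution[of s, OF s] o_apply)
  also have "\<dots> = (\<Prod>j=1..Suc p. bpow (?l j) (\<alpha> j))"
    by (rule prod_\<tau>)
  finally have 1: "(\<Prod>j=1..Suc p. bpow ((\<Sum>i\<in>{1..<j}. s i) + (1 - kraw_arg (\<rho> \<circ> \<tau>) j) * s j) ((\<alpha> \<circ> \<tau>) j)) =
     (\<Prod>j=1..Suc p. bpow (?l j) (\<alpha> j))" .
  have 2: "(\<Sum>i=1..Suc p. (\<alpha> \<circ> \<tau>) i) = (\<Sum>i=1..Suc p. \<alpha> i)"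
    using sum_\<tau>[of \<alpha>] by (simp only: o_apply)
  have "{1..<Suc p} = {1..p}" "{Suc p..p} = {}" by auto
  then have 3: "(\<Sum>i=1..Suc p. u s i) = (\<Sum>i=1..Suc p. s i)"
    using sum_conn_form[of "Suc p" s] s by simp
  show ?thesis unfolding kcoef_generating_function 1 2 3 ..
qed

text \<open>
Comparison of the coefficients of \<open>s\<^sup>\<nu>\<close> in \<open>kcoef_connection_generating_function\<close> after expanding the powers of
\<open>u\<close>.  As \<open>s\<^sub>d\<close> is fixed, only the exponents of \<open>s\<^sub>1, \<dots>, s\<^sub>p\<close> are compared; they determine \<open>\<nu>\<close> because \<open>|\<nu>| = n\<close>.
\<close>
theorem kcoef_connection:
  assumes \<nu>: "\<nu> \<in> multi_indices (Suc p) n"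
  shows "kcoef (Suc p) (kraw_arg (\<rho> \<circ> \<tau>)) N \<nu> (\<alpha> \<circ> \<tau>) =
    (\<Sum>\<mu>\<in>multi_indices (Suc p) n. conn_coef p \<rho> n \<nu> \<mu> * kcoef (Suc p) (kraw_arg \<rho>) N \<mu> \<alpha>)"
proof -
  let ?Q = "q (Suc p)"
  let ?ext = "\<lambda>\<nu>. \<nu>(Suc p := n - (\<Sum>i=1..p. \<nu> i))"
  define a where "a \<nu> = kcoef (Suc p) (kraw_arg (\<rho> \<circ> \<tau>)) N (?ext \<nu>) (\<alpha> \<circ> \<tau>) * (1 / ?Q) ^ (n - (\<Sum>i=1..p. \<nu> i))" for \<nu>
  define c where "c \<nu> \<mu> = (\<Prod>j=1..Suc p. conn_factor \<rho> j ^ \<mu> j) * (- \<rho> 1) ^ (\<Sum>i=1..p. \<nu> i) *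
     kcoef p (kraw_arg \<rho>') (real n) (\<lambda>j. \<nu> (Suc p - j)) (\<lambda>j. real (\<mu> (Suc p + 1 - j)))" for \<nu> \<mu>
  define b where "b \<nu> = (\<Sum>\<mu>\<in>multi_indices (Suc p) n. c \<nu> \<mu> * kcoef (Suc p) (kraw_arg \<rho>) N \<mu> \<alpha>)" for \<nu>
  have eq: "(\<Sum>\<nu>\<in>grid p n. a \<nu> * (\<Prod>i=1..p. s i ^ \<nu> i)) = (\<Sum>\<nu>\<in>grid p n. b \<nu> * (\<Prod>i=1..p. s i ^ \<nu> i))" for s
  proof -
    define t where "t = s(Suc p := 1 / ?Q)"
    have t: "t (Suc p) = 1 / ?Q" by (simp add: t_def)
    have ts: "(\<Prod>i=1..p. t i ^ \<nu> i) = (\<Prod>i=1..p. s i ^ \<nu> i)" for \<nu>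
      by (intro prod.cong) (auto simp: t_def)
    have "(\<Sum>\<nu>\<in>grid p n. a \<nu> * (\<Prod>i=1..p. s i ^ \<nu> i)) =
      (\<Sum>\<nu>\<in>multi_indices (Suc p) n. kcoef (Suc p) (kraw_arg (\<rho> \<circ> \<tau>)) N \<nu> (\<alpha> \<circ> \<tau>) * (\<Prod>i=1..Suc p. t i ^ \<nu> i))"
      unfolding sum_multi_indices_grid
    proof (intro sum.cong refl)
      fix \<nu>
      have "(\<Prod>i=1..p. t i ^ ?ext \<nu> i) = (\<Prod>i=1..p. t i ^ \<nu> i)"
        by (intro prod.cong) auto
      then have "(\<Prod>i=1..Suc p. t i ^ ?ext \<nu> i) = (1 / ?Q) ^ (n - (\<Sum>i=1..p. \<nu> i)) * (\<Prod>i=1..p. s i ^ \<nu> i)"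
        using t ts[of \<nu>] by (simp add: prod.nat_ivl_Suc')
      then show "a \<nu> * (\<Prod>i=1..p. s i ^ \<nu> i) =
          kcoef (Suc p) (kraw_arg (\<rho> \<circ> \<tau>)) N (?ext \<nu>) (\<alpha> \<circ> \<tau>) * (\<Prod>i=1..Suc p. t i ^ ?ext \<nu> i)"
        by (simp only: a_def mult.assoc)
    qed
    also have "\<dots> = (\<Sum>\<mu>\<in>multi_indices (Suc p) n. kcoef (Suc p) (kraw_arg \<rho>) N \<mu> \<alpha> * (\<Prod>i=1..Suc p. u t i ^ \<mu> i))"
      by (rule kcoef_connection_generating_function[where s = t, OF t])
    also have "\<dots> = (\<Sum>\<mu>\<in>multi_indices (Suc p) n. \<Sum>\<nu>\<in>grid p n.
        c \<nu> \<mu> * kcoef (Suc p) (kraw_arg \<rho>) N \<mu> \<alpha> * (\<Prod>i=1..p. s i ^ \<nu> i))"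
    proof (intro sum.cong refl)
      fix \<mu> assume "\<mu> \<in> multi_indices (Suc p) n"
      from conn_form_power_expansion[OF this, of t]
      show "kcoef (Suc p) (kraw_arg \<rho>) N \<mu> \<alpha> * (\<Prod>i=1..Suc p. u t i ^ \<mu> i) =
        (\<Sum>\<nu>\<in>grid p n. c \<nu> \<mu> * kcoef (Suc p) (kraw_arg \<rho>) N \<mu> \<alpha> * (\<Prod>i=1..p. s i ^ \<nu> i))"
        unfolding c_def[symmetric] ts by (simp only: sum_distrib_left mult_ac)
    qed
    also have "\<dots> = (\<Sum>\<nu>\<in>grid p n. b \<nu> * (\<Prod>i=1..p. s i ^ \<nu> i))"
      unfolding b_def sum_distrib_right by (rule sum.swap)
    finally show ?thesis .
  qed
  define \<nu>' where "\<nu>' = \<nu>(Suc p := 0)"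
  have s': "(\<Sum>i=1..p. \<nu>' i) = (\<Sum>i=1..p. \<nu> i)" by (intro sum.cong) (auto simp: \<nu>'_def)
  have n: "n - (\<Sum>i=1..p. \<nu> i) = \<nu> (Suc p)" "(\<Sum>i=1..p. \<nu> i) \<le> n" using \<nu> by (auto simp: multi_indices_def)
  have g: "\<nu>' \<in> grid p n" using \<nu> s' n unfolding grid_def by (auto simp: \<nu>'_def multi_indices_def)
  have ext: "\<nu>'(Suc p := \<nu> (Suc p)) = \<nu>" by (simp add: \<nu>'_def)
  have Q: "?Q > 0" using q_pos by simp
  have "a \<nu>' = b \<nu>'" using eq g by (rule monomials_coeff_eq)
  then have "kcoef (Suc p) (kraw_arg (\<rho> \<circ> \<tau>)) N \<nu> (\<alpha> \<circ> \<tau>) = ?Q ^ \<nu> (Suc p) * b \<nu>'"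
    unfolding a_def s' n ext using Q by (simp add: field_simps)
  also have "\<dots> = (\<Sum>\<mu>\<in>multi_indices (Suc p) n. conn_coef p \<rho> n \<nu> \<mu> * kcoef (Suc p) (kraw_arg \<rho>) N \<mu> \<alpha>)"
    unfolding b_def sum_distrib_left
  proof (intro sum.cong refl)
    fix \<mu>
    have "kcoef p (kraw_arg \<rho>') (real n) (\<lambda>j. \<nu>' (Suc p - j)) (\<lambda>j. real (\<mu> (Suc p + 1 - j))) =
      kcoef p (kraw_arg \<rho>') (real n) (\<lambda>j. \<nu> (Suc p - j)) (\<lambda>j. real (\<mu> (Suc p + 1 - j)))"
      by (rule kcoef_cong) (auto simp: \<nu>'_def)
    then show "?Q ^ \<nu> (Suc p) * (c \<nu>' \<mu> * kcoef (Suc p) (kraw_arg \<rho>) N \<mu> \<alpha>) =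
       conn_coef p \<rho> n \<nu> \<mu> * kcoef (Suc p) (kraw_arg \<rho>) N \<mu> \<alpha>"
      by (simp only: c_def conn_coef_def s' mult_ac)
  qed
  finally show ?thesis .
qed

lemma kraw_scale_\<tau>:
  "j \<in> {1..p} \<Longrightarrow> kraw_scale (\<rho> \<circ> \<tau>) j * (\<rho> 1 * q (Suc p) / (q (Suc p) + \<rho> 1)) = (\<rho> 1)\<^sup>2 * kraw_scale \<rho>' (Suc p - j)"
  "kraw_scale (\<rho> \<circ> \<tau>) (Suc p) * (\<rho> 1 * q (Suc p) / (q (Suc p) + \<rho> 1)) = (q (Suc p))\<^sup>2"
proof -
  assume j: "j \<in> {1..p}"
  have pos: "q j > 0" "q (Suc j) > 0" "q (Suc p) > 0" "\<rho> 1 > 0" "\<rho> (Suc j) > 0" "q (Suc p) + \<rho> 1 > 0"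
    using q_pos \<rho>_pos j by (auto intro: add_pos_pos)
  have r: "\<rho>' (Suc p - j) = \<rho> 1 * \<rho> (Suc j) * q (Suc p) / (q j * q (Suc j) * (q (Suc p) + \<rho> 1))"
    using j by (intro rho_tilde_eq) auto
  have t1: "tail_mass \<rho>' (Suc p - j) = q (Suc p) * (q j + \<rho> 1) / (q j * (q (Suc p) + \<rho> 1))"
    using tail_mass_rho_tilde[of "Suc p - j"] j
    by (simp only: diff_diff_cancel[of j "Suc p"] atLeastAtMost_iff) auto
  have t2: "tail_mass \<rho>' (p - j) = q (Suc p) * (q (Suc j) + \<rho> 1) / (q (Suc j) * (q (Suc p) + \<rho> 1))"
    using tail_mass_rho_tilde[of "p - j"] j by (simp add: Suc_diff_le)
  have c': "kraw_scale \<rho>' (Suc p - j) = tail_mass \<rho>' (Suc p - j) * tail_mass \<rho>' (p - j) / \<rho>' (Suc p - j)"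
    using j kraw_scale_tail_mass[of "Suc p - j" \<rho>'] by (simp add: Suc_diff_le)
  have "kraw_scale (\<rho> \<circ> \<tau>) j = tail_mass (\<rho> \<circ> \<tau>) j * tail_mass (\<rho> \<circ> \<tau>) (j - 1) / (\<rho> \<circ> \<tau>) j"
    using j by (intro kraw_scale_tail_mass) auto
  also have "\<dots> = (q (Suc j) + \<rho> 1) * (q j + \<rho> 1) / \<rho> (Suc j)"
  proof -
    have "tail_mass (\<rho> \<circ> \<tau>) (j - 1) = q j + \<rho> 1" using tail_mass_\<tau>[of "j - 1"] j by auto
    moreover have "tail_mass (\<rho> \<circ> \<tau>) j = q (Suc j) + \<rho> 1" using tail_mass_\<tau>[of j] j by auto
    ultimately show ?thesis using \<tau>_less[OF j] by (simp only: o_apply)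
  qed
  finally have c: "kraw_scale (\<rho> \<circ> \<tau>) j = (q (Suc j) + \<rho> 1) * (q j + \<rho> 1) / \<rho> (Suc j)" .
  show "kraw_scale (\<rho> \<circ> \<tau>) j * (\<rho> 1 * q (Suc p) / (q (Suc p) + \<rho> 1)) = (\<rho> 1)\<^sup>2 * kraw_scale \<rho>' (Suc p - j)"
    unfolding c c' t1 t2 r power2_eq_square using pos by (simp add: divide_simps)
next
  have pos: "q (Suc p) > 0" "\<rho> 1 > 0" "q (Suc p) + \<rho> 1 > 0"
    using q_pos[of "Suc p"] \<rho>_pos by (auto intro: add_pos_pos)
  have "kraw_scale (\<rho> \<circ> \<tau>) (Suc p) = tail_mass (\<rho> \<circ> \<tau>) (Suc p) * tail_mass (\<rho> \<circ> \<tau>) (Suc p - 1) / (\<rho> \<circ> \<tau>) (Suc p)"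
    by (intro kraw_scale_tail_mass) auto
  also have "\<dots> = q (Suc p) * (q (Suc p) + \<rho> 1) / \<rho> 1"
    using tail_mass_\<tau>_all tail_mass_\<tau>[of p] \<tau>_last by simp
  finally show "kraw_scale (\<rho> \<circ> \<tau>) (Suc p) * (\<rho> 1 * q (Suc p) / (q (Suc p) + \<rho> 1)) = (q (Suc p))\<^sup>2"
    using pos by (simp add: divide_simps power2_eq_square)
qed

text \<open>
The binomial coefficient \<open>N choose n\<close> is the only trace of \<open>N\<close> in the norms and occurs in the numerator and in the
denominator.  After squaring, the remaining constants agree by \<open>conn_factor_scale\<close> and \<open>kraw_scale_\<tau>\<close>; the sign
comes from the powers of \<open>- \<rho>\<^sub>1\<close>.
\<close>
theorem normalized_conn_coef:
  assumes \<nu>: "\<nu> \<in> multi_indices (Suc p) n" and \<mu>: "\<mu> \<in> multi_indices (Suc p) n" and n: "n \<le> N"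
  shows "conn_coef p \<rho> n \<nu> \<mu> * sqrt (multinom (Suc p) N \<mu> * (\<Prod>j=1..Suc p. kraw_scale \<rho> j ^ \<mu> j)) /
      sqrt (multinom (Suc p) N \<nu> * (\<Prod>j=1..Suc p. kraw_scale (\<rho> \<circ> \<tau>) j ^ \<nu> j)) =
    (- 1) ^ (n + \<nu> (Suc p)) * sqrt (kraw_weight p \<rho>' n (\<lambda>j. \<mu> (Suc p + 1 - j))) *
      kraw_hat p \<rho>' n (\<lambda>j. \<nu> (Suc p - j)) (\<lambda>j. real (\<mu> (Suc p + 1 - j)))"
proof -
  define w where "w = \<rho> 1 * q (Suc p) / (q (Suc p) + \<rho> 1)"
  have pos: "q (Suc p) > 0" "\<rho> 1 > 0" using q_pos[of "Suc p"] \<rho>_pos by auto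
  then have w: "w > 0" unfolding w_def by (intro divide_pos_pos mult_pos_pos add_pos_pos)
  have psplit: "(\<Prod>j=1..Suc p. f j) = f 1 * (\<Prod>j=1..p. f (Suc j))" for f :: "nat \<Rightarrow> real"
    unfolding prod.shift_bounds_cl_Suc_ivl[symmetric] by (simp add: prod.atLeast_Suc_atMost)
  have psplit': "(\<Prod>j=1..Suc p. f j) = (\<Prod>j=1..p. f j) * f (Suc p)" for f :: "nat \<Rightarrow> real"
    by (simp add: prod.nat_ivl_Suc')
  let ?x = "\<lambda>j. \<mu> (Suc p + 1 - j)"
  let ?k = "\<lambda>j. \<nu> (Suc p - j)"
  have x_rev: "?x (p + 1 - j) = \<mu> (Suc j)" if "j \<in> {1..p}" for j using that by (simp add: Suc_diff_le)
  have k_rev: "?k (p + 1 - j) = \<nu> j" if "j \<in> {1..p}" for j using that by (simp add: Suc_diff_le)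
  have "(\<Sum>i=1..p. ?x i) = (\<Sum>j=1..p. \<mu> (Suc j))"
    unfolding sum_rev[of ?x, symmetric] by (intro sum.cong refl x_rev)
  moreover have "(\<Sum>j=1..Suc p. \<mu> j) = \<mu> 1 + (\<Sum>j=1..p. \<mu> (Suc j))"
    unfolding sum.shift_bounds_cl_Suc_ivl[symmetric] by (simp add: sum.atLeast_Suc_atMost)
  moreover have \<mu>n: "(\<Sum>j=1..Suc p. \<mu> j) = n" and \<nu>n: "(\<Sum>j=1..Suc p. \<nu> j) = n"
    using \<mu> \<nu> by (auto simp: multi_indices_def)
  ultimately have x: "n - (\<Sum>i=1..p. ?x i) = \<mu> 1" "(\<Sum>i=1..p. ?x i) \<le> n" by linarith+
  have k_sum: "(\<Sum>i=1..p. ?k i) = (\<Sum>j=1..p. \<nu> j)"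
    unfolding sum_rev[of ?k, symmetric] by (intro sum.cong refl k_rev)
  have \<nu>_sum: "n = (\<Sum>j=1..p. \<nu> j) + \<nu> (Suc p)" using \<nu>n by simp
  have k: "n - (\<Sum>i=1..p. ?k i) = \<nu> (Suc p)" "(\<Sum>i=1..p. ?k i) \<le> n" using k_sum \<nu>_sum by linarith+
  have rev: "(\<Prod>i=1..p. f i (?x i)) = (\<Prod>j=1..p. f (p + 1 - j) (\<mu> (Suc j)))" for f :: "nat \<Rightarrow> nat \<Rightarrow> real"
    unfolding prod_rev[of "\<lambda>i. f i (?x i)", symmetric] by (intro prod.cong refl) (simp only: x_rev)
  have rev': "(\<Prod>i=1..p. f i (?k i)) = (\<Prod>j=1..p. f (p + 1 - j) (\<nu> j))" for f :: "nat \<Rightarrow> nat \<Rightarrow> real"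
    unfolding prod_rev[of "\<lambda>i. f i (?k i)", symmetric] by (intro prod.cong refl) (simp only: k_rev)
  define A B where "A = (\<Prod>j=1..Suc p. conn_factor \<rho> j ^ \<mu> j)" and "B = \<rho> 1 ^ (\<Sum>i=1..p. \<nu> i) * q (Suc p) ^ \<nu> (Suc p)"
  define C D where "C = (\<Prod>j=1..Suc p. kraw_scale \<rho> j ^ \<mu> j)" and "D = (\<Prod>j=1..Suc p. kraw_scale (\<rho> \<circ> \<tau>) j ^ \<nu> j)"
  define P E where "P = (\<Prod>i=1..p. \<rho>' i ^ ?x i) * tail_mass \<rho>' p ^ \<mu> 1" and "E = (\<Prod>i=1..p. kraw_scale \<rho>' i ^ ?k i)"
  define K where "K = kcoef p (kraw_arg \<rho>') (real n) ?k (\<lambda>j. real (?x j))"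
  define bn where "bn = real (N choose n)"
  define mx mk where "mx = multinom p n ?x" and "mk = multinom p n ?k"
  have mpos: "mx > 0" "mk > 0" "bn > 0" using n by (simp_all add: mx_def mk_def bn_def multinom_pos)
  \<comment> \<open>the constant \<open>w\<close> is distributed over the entries of \<open>\<mu>\<close> and of \<open>\<nu>\<close>, both of which have sum \<open>n\<close>\<close>
  have wn: "w ^ n = (\<Prod>j=1..Suc p. w ^ \<mu> j)" "w ^ n = (\<Prod>j=1..Suc p. w ^ \<nu> j)"
    by (simp_all only: power_sum[symmetric] \<mu>n \<nu>n)
  have Apos: "A > 0" unfolding A_def
  proof (intro prod_pos ballI zero_less_power)
    fix j assume "j \<in> {1..Suc p}"
    then show "conn_factor \<rho> j > 0"
      using q_pos[of 1] q_pos[of j] q_pos[of "j - 1"] \<rho>(1)[of j] by (auto simp: conn_factor_def)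
  qed
  have Bpos: "B > 0" using pos by (simp add: B_def)
  \<comment> \<open>the norms for \<open>\<tau>\<rho>\<close> are positive, as \<open>\<tau>\<rho>\<close> satisfies the same conditions as \<open>\<rho>\<close>\<close>
  have \<rho>\<tau>: "(\<rho> \<circ> \<tau>) i > 0" if "i \<in> {1..Suc p}" for i
    using bij_betwE[OF bij_\<tau>] that \<rho>(1) by auto
  have \<rho>\<tau>_sum: "(\<Sum>i=1..Suc p. (\<rho> \<circ> \<tau>) i) < 1" using \<rho>(2) sum_\<tau>[of \<rho>] by (simp only: o_apply)
  have Dpos: "D > 0" unfolding D_def using \<rho>\<tau> \<rho>\<tau>_sum by (rule kraw_scale_prod_pos)
  have "A\<^sup>2 * C * w ^ n = (\<Prod>j=1..Suc p. ((conn_factor \<rho> j)\<^sup>2 * kraw_scale \<rho> j * w) ^ \<mu> j)"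
    unfolding A_def C_def wn(1) by (simp only: prod_power_distrib prod.distrib power_mult_distrib power_commutes power_mult[symmetric] mult.commute)
  also have "\<dots> = P"
  proof -
    have "(\<Prod>j=1..p. ((conn_factor \<rho> (Suc j))\<^sup>2 * kraw_scale \<rho> (Suc j) * w) ^ \<mu> (Suc j)) =
      (\<Prod>j=1..p. \<rho>' (p + 1 - j) ^ \<mu> (Suc j))"
      unfolding w_def Suc_eq_plus1[of p, symmetric]
      by (intro prod.cong refl) (simp only: conn_factor_scale(1))
    moreover have "(conn_factor \<rho> 1)\<^sup>2 * kraw_scale \<rho> 1 * w = tail_mass \<rho>' p"
      unfolding w_def by (rule conn_factor_scale(2))
    ultimately show ?thesis
      unfolding psplit P_def rev[of "\<lambda>i m. \<rho>' i ^ m"] by (simp only: mult.commute)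
  qed
  finally have ACP: "A\<^sup>2 * C * w ^ n = P" .
  have "D * w ^ n = (\<Prod>j=1..Suc p. (kraw_scale (\<rho> \<circ> \<tau>) j * w) ^ \<nu> j)"
    unfolding D_def wn(2) by (simp only: prod.distrib power_mult_distrib)
  also have "\<dots> = (\<Prod>j=1..p. ((\<rho> 1)\<^sup>2 * kraw_scale \<rho>' (Suc p - j)) ^ \<nu> j) * (q (Suc p))\<^sup>2 ^ \<nu> (Suc p)"
    unfolding psplit' w_def kraw_scale_\<tau>(2)
    by (intro arg_cong2[where f = "(*)"] prod.cong refl) (simp only: kraw_scale_\<tau>(1))
  also have "\<dots> = B\<^sup>2 * E"
    unfolding E_def rev'[of "\<lambda>i m. kraw_scale \<rho>' i ^ m"] B_def power_mult_distrib prod.distrib power_sum[symmetric]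
    by (simp add: power_mult[symmetric] mult.commute)
  finally have DE: "D * w ^ n = B\<^sup>2 * E" .
  have key: "(A * B)\<^sup>2 * C / D = P / E"
  proof -
    have "(A * B)\<^sup>2 * C / D = (A\<^sup>2 * C * w ^ n) * (B\<^sup>2 / (D * w ^ n))"
      using w Dpos by (simp add: field_simps)
    also have "\<dots> = P / E" unfolding ACP DE using Bpos by simp
    finally show ?thesis .
  qed
  have m\<mu>: "multinom (Suc p) N \<mu> = bn * mx"
    unfolding bn_def mx_def
  proof (rule multinom_Suc[OF n \<mu>n])
    show "(\<Prod>i=1..p. fact (?x i)) * fact (n - (\<Sum>i=1..p. ?x i)) = (\<Prod>i=1..Suc p. fact (\<mu> i) :: real)"
      unfolding x(1) psplit rev[of "\<lambda>i. fact"] by simp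
  qed
  have m\<nu>: "multinom (Suc p) N \<nu> = bn * mk"
    unfolding bn_def mk_def
  proof (rule multinom_Suc[OF n \<nu>n])
    show "(\<Prod>i=1..p. fact (?k i)) * fact (n - (\<Sum>i=1..p. ?k i)) = (\<Prod>i=1..Suc p. fact (\<nu> i) :: real)"
      unfolding k(1) psplit' rev'[of "\<lambda>i. fact"] by simp
  qed
  have sgn: "(- 1 :: real) ^ (\<Sum>i=1..p. \<nu> i) = (- 1) ^ (n + \<nu> (Suc p))"
    unfolding \<nu>_sum by (simp add: power_add)
  have "(- \<rho> 1) ^ (\<Sum>i=1..p. \<nu> i) = (- 1) ^ (n + \<nu> (Suc p)) * \<rho> 1 ^ (\<Sum>i=1..p. \<nu> i)"
    unfolding sgn[symmetric] by (simp flip: power_mult_distrib)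
  then have cc: "conn_coef p \<rho> n \<nu> \<mu> = (- 1) ^ (n + \<nu> (Suc p)) * (A * B) * K"
    by (simp only: conn_coef_def A_def B_def K_def mult_ac)
  have "A * B * sqrt (bn * mx * C) / sqrt (bn * mk * D) = sqrt ((A * B)\<^sup>2) * sqrt (bn * mx * C) / sqrt (bn * mk * D)"
    using Apos Bpos by simp
  also have "\<dots> = sqrt ((A * B)\<^sup>2 * (bn * mx * C) / (bn * mk * D))"
    by (simp only: real_sqrt_mult real_sqrt_divide)
  also have "(A * B)\<^sup>2 * (bn * mx * C) / (bn * mk * D) = mx / mk * ((A * B)\<^sup>2 * C / D)"
    using mpos Dpos by (simp add: field_simps)
  also have "\<dots> = mx * P / (mk * E)" unfolding key by simp
  finally have root: "A * B * sqrt (bn * mx * C) / sqrt (bn * mk * D) = sqrt (mx * P) / sqrt (mk * E)"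
    by (simp only: real_sqrt_divide)
  have hat: "kraw_hat p \<rho>' n ?k (\<lambda>j. real (?x j)) = K / sqrt (mk * E)"
    unfolding K_def mk_def E_def using rho_tilde_pos rho_tilde_sum_less_1 k(2) by (rule kraw_hat_eq_kcoef)
  have weight: "kraw_weight p \<rho>' n ?x = mx * P"
    unfolding kraw_weight_eq x(1) mx_def P_def tail_mass_def by (simp only: mult.assoc)
  have "conn_coef p \<rho> n \<nu> \<mu> * sqrt (bn * mx * C) / sqrt (bn * mk * D) =
     (- 1) ^ (n + \<nu> (Suc p)) * (A * B * sqrt (bn * mx * C) / sqrt (bn * mk * D)) * K"
    unfolding cc by simp
  then show ?thesis
    unfolding m\<mu> m\<nu> C_def[symmetric] D_def[symmetric] hat weight root by simp
qed

text \<open>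
The expansion exists by \<open>kcoef_connection\<close>, and the orthonormal polynomials being linearly independent,
no other family of coefficients can satisfy it.
\<close>
theorem kraw_conn_eq:
  assumes \<nu>: "\<nu> \<in> multi_indices (Suc p) n" and \<mu>: "\<mu> \<in> multi_indices (Suc p) n" and n: "n \<le> N"
  shows "kraw_conn (Suc p) \<tau> \<rho> N \<nu> \<mu> =
    (- 1) ^ (n + \<nu> (Suc p)) * sqrt (kraw_weight p \<rho>' n (\<lambda>j. \<mu> (Suc p + 1 - j))) *
      kraw_hat p \<rho>' n (\<lambda>j. \<nu> (Suc p - j)) (\<lambda>j. real (\<mu> (Suc p + 1 - j)))"
proof -
  let ?M = "multi_indices (Suc p) n"
  define A where "A \<mu> = sqrt (multinom (Suc p) N \<mu> * (\<Prod>j=1..Suc p. kraw_scale \<rho> j ^ \<mu> j))" for \<mu>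
  define B where "B = sqrt (multinom (Suc p) N \<nu> * (\<Prod>j=1..Suc p. kraw_scale (\<rho> \<circ> \<tau>) j ^ \<nu> j))"
  define c where "c \<mu> = (if \<mu> \<in> ?M then conn_coef p \<rho> n \<nu> \<mu> * A \<mu> / B else 0)" for \<mu>
  have \<nu>n: "(\<Sum>i=1..Suc p. \<nu> i) = n" using \<nu> by (simp add: multi_indices_def)
  have Mn: "(\<Sum>i=1..Suc p. \<mu> i) \<le> N" if "\<mu> \<in> ?M" for \<mu> using that n by (simp add: multi_indices_def)
  have \<rho>\<tau>: "(\<rho> \<circ> \<tau>) i > 0" if "i \<in> {1..Suc p}" for i
    using bij_betwE[OF bij_\<tau>] that \<rho>(1) by auto
  have \<rho>\<tau>_sum: "(\<Sum>i=1..Suc p. (\<rho> \<circ> \<tau>) i) < 1" using \<rho>(2) sum_\<tau>[of \<rho>] by (simp only: o_apply)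
  have Apos: "A \<mu> > 0" for \<mu>
    unfolding A_def using kraw_scale_prod_pos[of "Suc p" \<rho> \<mu>] \<rho> multinom_pos[of "Suc p" N \<mu>] by simp
  have hat: "kraw_hat (Suc p) \<rho> N \<mu> \<alpha> = kcoef (Suc p) (kraw_arg \<rho>) (real N) \<mu> \<alpha> / A \<mu>" if "\<mu> \<in> ?M" for \<mu> \<alpha>
    unfolding A_def using \<rho> Mn[OF that] by (rule kraw_hat_eq_kcoef)
  have hat\<tau>: "kraw_hat (Suc p) (\<rho> \<circ> \<tau>) N \<nu> \<alpha> = kcoef (Suc p) (kraw_arg (\<rho> \<circ> \<tau>)) (real N) \<nu> \<alpha> / B" for \<alpha>
    unfolding B_def using \<rho>\<tau> \<rho>\<tau>_sum Mn[OF \<nu>] by (rule kraw_hat_eq_kcoef)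
  have expansion: "kraw_hat (Suc p) (\<rho> \<circ> \<tau>) N \<nu> (\<alpha> \<circ> \<tau>) = (\<Sum>\<mu>\<in>?M. c \<mu> * kraw_hat (Suc p) \<rho> N \<mu> \<alpha>)" for \<alpha>
    unfolding hat\<tau> kcoef_connection[OF \<nu>] sum_divide_distrib
  proof (intro sum.cong refl)
    fix \<mu> assume "\<mu> \<in> ?M"
    then show "conn_coef p \<rho> n \<nu> \<mu> * kcoef (Suc p) (kraw_arg \<rho>) (real N) \<mu> \<alpha> / B = c \<mu> * kraw_hat (Suc p) \<rho> N \<mu> \<alpha>"
      using Apos[of \<mu>] by (simp add: c_def hat)
  qed
  have "kraw_conn (Suc p) \<tau> \<rho> N \<nu> = c"
    unfolding kraw_conn_def \<nu>n
  proof (rule the_equality)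
    show "(\<forall>\<mu>. \<mu> \<notin> ?M \<longrightarrow> c \<mu> = 0) \<and>
      (\<forall>\<alpha>. kraw_hat (Suc p) (\<rho> \<circ> \<tau>) N \<nu> (\<alpha> \<circ> \<tau>) = (\<Sum>\<mu>\<in>?M. c \<mu> * kraw_hat (Suc p) \<rho> N \<mu> \<alpha>))"
      using expansion by (simp add: c_def)
  next
    fix b assume b: "(\<forall>\<mu>. \<mu> \<notin> ?M \<longrightarrow> b \<mu> = 0) \<and>
      (\<forall>\<alpha>. kraw_hat (Suc p) (\<rho> \<circ> \<tau>) N \<nu> (\<alpha> \<circ> \<tau>) = (\<Sum>\<mu>\<in>?M. b \<mu> * kraw_hat (Suc p) \<rho> N \<mu> \<alpha>))"
    have zero: "(\<Sum>\<mu>\<in>?M. (b \<mu> - c \<mu>) * kraw_hat (Suc p) \<rho> N \<mu> \<alpha>) = 0" for \<alpha>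
      using b expansion[of \<alpha>] by (simp add: left_diff_distrib sum_subtractf)
    have sub: "?M \<subseteq> grid (Suc p) N" using n by (auto simp: multi_indices_def grid_def)
    have "b \<mu> - c \<mu> = 0" if "\<mu> \<in> ?M" for \<mu>
      using \<rho> finite_multi_indices sub zero that by (rule kraw_hat_linear_independent)
    then show "b = c" using b by (auto simp: fun_eq_iff c_def)
  qed
  then have "kraw_conn (Suc p) \<tau> \<rho> N \<nu> \<mu> = conn_coef p \<rho> n \<nu> \<mu> * A \<mu> / B"
    using \<mu> by (simp add: c_def)
  then show ?thesis
    unfolding A_def B_def normalized_conn_coef[OF \<nu> \<mu> n] .
qed

end

end

theorem theorem8p5:
  fixes d n N :: nat and \<rho> :: "nat \<Rightarrow> real" and \<nu> \<mu> :: "nat \<Rightarrow> nat"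
  assumes "d \<ge> 2"
    and "\<And>i. i \<in> {1..d} \<Longrightarrow> \<rho> i \<in> {0<..<1}"
    and "(\<Sum>i=1..d. \<rho> i) < 1"
    and "\<nu> \<in> multi_indices d n"
    and "\<mu> \<in> multi_indices d n"
    and "n \<le> N"
  shows "kraw_conn d (cycle_of_list [1..<d + 1]) \<rho> N \<nu> \<mu> =
      (- 1) ^ (n + \<nu> d) * sqrt (kraw_weight (d - 1) (rho_hat \<rho>) n \<nu>) *
      kraw_hat (d - 1) (rho_hat \<rho>) n (\<lambda>j. \<mu> (j + 1)) (\<lambda>j. real (\<nu> j))
    \<and> kraw_conn d (cycle_of_list [1..<d + 1]) \<rho> N \<nu> \<mu> =
      (- 1) ^ (n + \<nu> d) *
      sqrt (kraw_weight (d - 1) (rho_tilde d \<rho>) n (\<lambda>j. \<mu> (d + 1 - j))) *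
      kraw_hat (d - 1) (rho_tilde d \<rho>) n (\<lambda>j. \<nu> (d - j)) (\<lambda>j. real (\<mu> (d + 1 - j)))"
proof -
  define p where "p = d - 1"
  have d: "d = Suc p" "d - 1 = p" and p: "p \<ge> 1" using assms(1) by (auto simp: p_def)
  have \<tau>_less: "cycle_of_list [1..<d + 1] j = Suc j" if "j \<in> {1..p}" for j
    using cycle_of_list_upt[of j d] that d(1) by (auto simp del: upt_Suc)
  have \<tau>_last: "cycle_of_list [1..<d + 1] (Suc p) = 1"
    using cycle_of_list_upt[of "Suc p" d] d(1) by (auto simp del: upt_Suc)
  have \<rho>: "\<And>i. i \<in> {1..Suc p} \<Longrightarrow> \<rho> i > 0" "(\<Sum>i=1..Suc p. \<rho> i) < 1"
    using assms(2,3) unfolding d(1) by auto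
  have \<mu>\<nu>: "\<nu> \<in> multi_indices (Suc p) n" "\<mu> \<in> multi_indices (Suc p) n" using assms(4,5) d by auto
  let ?x = "\<lambda>j. \<mu> (Suc p + 1 - j)"
  let ?k = "\<lambda>j. \<nu> (Suc p - j)"
  let ?\<rho>' = "rho_tilde (Suc p) \<rho>"
  have conn: "kraw_conn (Suc p) (cycle_of_list [1..<d + 1]) \<rho> N \<nu> \<mu> =
      (- 1) ^ (n + \<nu> (Suc p)) * sqrt (kraw_weight p ?\<rho>' n ?x) * kraw_hat p ?\<rho>' n ?k (\<lambda>j. real (?x j))"
    using p \<rho> \<tau>_less \<tau>_last \<mu>\<nu> assms(6) by (rule kraw_conn_eq)
  have "sqrt (kraw_weight p ?\<rho>' n ?x) * kraw_hat p ?\<rho>' n ?k (\<lambda>j. real (?x j)) =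
     sqrt (kraw_weight p (rho_hat \<rho>) n \<nu>) * kraw_hat p (rho_hat \<rho>) n (\<lambda>j. \<mu> (j + 1)) (\<lambda>j. real (\<nu> j))"
  proof (rule kraw_hat_duality)
    show "?\<rho>' j > 0" if "j \<in> {1..p}" for j using p \<rho> that by (rule rho_tilde_pos)
    show "(\<Sum>i=1..p. ?\<rho>' i) < 1" using p \<rho> by (rule rho_tilde_sum_less_1)
    show "rho_hat \<rho> j = dual_rho p ?\<rho>' j" if "j \<in> {1..p}" for j
      using p \<rho> that by (rule rho_hat_eq_dual_rho_tilde)
    have "(\<Sum>i=1..p. ?x i) = (\<Sum>i\<in>{2..Suc p}. \<mu> i)"
      by (rule sum.reindex_bij_witness[of _ "\<lambda>i. Suc p + 1 - i" "\<lambda>i. Suc p + 1 - i"]) auto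
    also have "\<dots> \<le> (\<Sum>i=1..Suc p. \<mu> i)" by (rule sum_mono2) auto
    also have "\<dots> = n" using \<mu>\<nu> by (simp add: multi_indices_def)
    finally show "(\<Sum>i=1..p. ?x i) \<le> n" .
    have "(\<Sum>i=1..p. ?k i) = (\<Sum>i=1..p. \<nu> i)"
      by (rule sum.reindex_bij_witness[of _ "\<lambda>i. Suc p - i" "\<lambda>i. Suc p - i"]) auto
    also have "\<dots> \<le> (\<Sum>i=1..Suc p. \<nu> i)" by (rule sum_mono2) auto
    also have "\<dots> = n" using \<mu>\<nu> by (simp add: multi_indices_def)
    finally show "(\<Sum>i=1..p. ?k i) \<le> n" .
  qed (auto simp: Suc_diff_le)
  then show ?thesis
    using conn unfolding d(2) unfolding d(1) by (simp add: mult.assoc del: upt_Suc)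
qed

end
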